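(* Let $G=(V,E)$ be a connected finite $\delta$-hyperbolic graph. Let $\{x,y\}$ be a mutually distant pair of vertices of $G$, let $c$ be a middle vertex of a shortest $(x,y)$-path, and let $T$ be a breadth-first-search tree of $G$ rooted at $c$. Then for every vertex $v$ of $G$, $e_G(v)\le e_T(v)\le e_G(v)+4\delta+1$. Consequently, $G$ admits an eccentricity $(4\delta+1)$-approximating spanning tree constructible in $O(\delta|E|)$ time.
   Context: $G$ is $\delta$-hyperbolic if for any four vertices $u,v,w,x$ the two larger of $d(u,v)+d(w,x)$, $d(u,w)+d(v,x)$, $d(u,x)+d(v,w)$ differ by at most $2\delta$ ($d$ = shortest-path distance). For a graph $H$, $e_H(v)=\max_u d_H(v,u)$; $F(v)=\{u: d_G(u,v)=e_G(v)\}$. $\{x,y\}$ is mutually distant if $x\in F(y)$ and $y\in F(x)$. A middle vertex of a shortest $(x,y)$-path is a vertex $c$ on it with $\min\{d(x,c),d(y,c)\}=\lfloor d(x,y)/2\rfloor$. A BFS tree rooted at $c$ is a spanning tree preserving all distances from $c$. A spanning tree $T$ is eccentricity $k$-approximating if $e_T(v)\le e_G(v)+k$ for all $v$.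
   Formalization: The time bound O(δ|E|) is stated as O((δ+1)(|E|+1)), since for δ = 0 (e.g. trees) or a single vertex the literal bound is zero, which no algorithm meets; for δ ≥ 1/2 and |E| ≥ 1 the two bounds agree up to a constant. *)

theory Defs
  imports Complex_Main
begin

section \<open>Finite simple graphs\<close>

text \<open>An undirected graph is given by its vertex set \<open>V\<close> and its set \<open>E\<close> of two-element edges.\<close>

definition simple_graph :: "'a set \<Rightarrow> 'a set set \<Rightarrow> bool" where
  "simple_graph V E \<longleftrightarrow> finite V \<and> (\<forall>e\<in>E. e \<subseteq> V \<and> card e = 2)"

definition walk :: "'a set \<Rightarrow> 'a set set \<Rightarrow> 'a \<Rightarrow> 'a list \<Rightarrow> 'a \<Rightarrow> bool" where
  "walk V E u p v \<longleftrightarrow>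
     p \<noteq> [] \<and> set p \<subseteq> V \<and> hd p = u \<and> last p = v \<and> successively (\<lambda>a b. {a, b} \<in> E) p"

definition connected_graph :: "'a set \<Rightarrow> 'a set set \<Rightarrow> bool" where
  "connected_graph V E \<longleftrightarrow>
     simple_graph V E \<and> V \<noteq> {} \<and> (\<forall>u\<in>V. \<forall>v\<in>V. \<exists>p. walk V E u p v)"

text \<open>Shortest-path distance. It is only used in connected graphs, where the minimum exists.\<close>

definition gdist :: "'a set \<Rightarrow> 'a set set \<Rightarrow> 'a \<Rightarrow> 'a \<Rightarrow> nat" where
  "gdist V E u v = (LEAST k. \<exists>p. walk V E u p v \<and> length p = Suc k)"

definition shortest_path :: "'a set \<Rightarrow> 'a set set \<Rightarrow> 'a \<Rightarrow> 'a list \<Rightarrow> 'a \<Rightarrow> bool" where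
  "shortest_path V E u p v \<longleftrightarrow> walk V E u p v \<and> length p = Suc (gdist V E u v)"

definition ecc :: "'a set \<Rightarrow> 'a set set \<Rightarrow> 'a \<Rightarrow> nat" where
  "ecc V E v = Max ((\<lambda>u. gdist V E v u) ` V)"

definition furthest :: "'a set \<Rightarrow> 'a set set \<Rightarrow> 'a \<Rightarrow> 'a set" where
  "furthest V E v = {u \<in> V. gdist V E u v = ecc V E v}"

text \<open>The case \<open>x = y\<close> is not excluded; it can only occur in the one-vertex graph.\<close>

definition mutually_distant :: "'a set \<Rightarrow> 'a set set \<Rightarrow> 'a \<Rightarrow> 'a \<Rightarrow> bool" where
  "mutually_distant V E x y \<longleftrightarrow> x \<in> furthest V E y \<and> y \<in> furthest V E x"

definition middle_vertex :: "'a set \<Rightarrow> 'a set set \<Rightarrow> 'a \<Rightarrow> 'a list \<Rightarrow> 'a \<Rightarrow> 'a \<Rightarrow> bool" where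
  "middle_vertex V E x p y c \<longleftrightarrow>
     c \<in> set p \<and> min (gdist V E x c) (gdist V E y c) = gdist V E x y div 2"

text \<open>The difference of the two largest of the three distance sums is at most \<open>2\<delta>\<close>.
  Taking four equal vertices shows that \<open>\<delta> \<ge> 0\<close> whenever \<open>V\<close> is nonempty.\<close>

definition hyperbolic :: "'a set \<Rightarrow> 'a set set \<Rightarrow> real \<Rightarrow> bool" where
  "hyperbolic V E \<delta> \<longleftrightarrow>
     (\<forall>u\<in>V. \<forall>v\<in>V. \<forall>w\<in>V. \<forall>x\<in>V.
        let s = sort [gdist V E u v + gdist V E w x,
                      gdist V E u w + gdist V E v x,
                      gdist V E u x + gdist V E v w]
        in real (s ! 2) - real (s ! 1) \<le> 2 * \<delta>)"

text \<open>A cycle is a closed walk \<open>v\<^sub>0, \<dots>, v\<^sub>k = v\<^sub>0\<close> with \<open>k \<ge> 3\<close> and \<open>v\<^sub>1, \<dots>, v\<^sub>k\<close> distinct.\<close>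

definition is_cycle :: "'a set \<Rightarrow> 'a set set \<Rightarrow> 'a list \<Rightarrow> bool" where
  "is_cycle V E p \<longleftrightarrow> length p \<ge> 4 \<and> distinct (tl p) \<and> walk V E (hd p) p (hd p)"

definition is_tree :: "'a set \<Rightarrow> 'a set set \<Rightarrow> bool" where
  "is_tree V E \<longleftrightarrow> connected_graph V E \<and> (\<nexists>p. is_cycle V E p)"

definition spanning_tree :: "'a set \<Rightarrow> 'a set set \<Rightarrow> 'a set set \<Rightarrow> bool" where
  "spanning_tree V E T \<longleftrightarrow> T \<subseteq> E \<and> is_tree V T"

definition bfs_tree :: "'a set \<Rightarrow> 'a set set \<Rightarrow> 'a \<Rightarrow> 'a set set \<Rightarrow> bool" where
  "bfs_tree V E c T \<longleftrightarrow> spanning_tree V E T \<and> (\<forall>v\<in>V. gdist V T c v = gdist V E c v)"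

definition ecc_approx_spanning_tree ::
    "'a set \<Rightarrow> 'a set set \<Rightarrow> real \<Rightarrow> 'a set set \<Rightarrow> bool" where
  "ecc_approx_spanning_tree V E k T \<longleftrightarrow>
     spanning_tree V E T \<and> (\<forall>v\<in>V. real (ecc V T v) \<le> real (ecc V E v) + k)"

section \<open>Machine model for running times\<close>

text \<open>
  A random access machine under the uniform cost measure, with addition and truncated subtraction
  as its only arithmetic, presented as a structured language. A program uses finitely many
  registers and finitely many random access arrays of natural numbers, both named by numbers.
  An assignment, an array write, a test and a skip each cost one unit. Since expressions
  are part of the program text, a unit stands for a number of elementary machine steps that is
  bounded by a constant depending only on the program.
\<close>

record store =
  reg :: "nat \<Rightarrow> nat"
  arr :: "nat \<Rightarrow> nat \<Rightarrow> nat"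

datatype aexp = Num nat | Reg nat | Read nat aexp | Plus aexp aexp | Minus aexp aexp

datatype bexp = Less aexp aexp | Neg bexp | Conj bexp bexp

datatype prog =
    Skip
  | Assign nat aexp
  | Write nat aexp aexp
  | Seq prog prog
  | If bexp prog prog
  | While bexp prog

fun aval :: "aexp \<Rightarrow> store \<Rightarrow> nat" where
  "aval (Num k) s = k"
| "aval (Reg x) s = reg s x"
| "aval (Read a i) s = arr s a (aval i s)"
| "aval (Plus e f) s = aval e s + aval f s"
| "aval (Minus e f) s = aval e s - aval f s"

fun bval :: "bexp \<Rightarrow> store \<Rightarrow> bool" where
  "bval (Less e f) s \<longleftrightarrow> aval e s < aval f s"
| "bval (Neg b) s \<longleftrightarrow> \<not> bval b s"
| "bval (Conj b b') s \<longleftrightarrow> bval b s \<and> bval b' s"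

text \<open>\<open>exec P s t s'\<close>: started in \<open>s\<close>, the program \<open>P\<close> halts in \<open>s'\<close> after \<open>t\<close> units of time.\<close>

inductive exec :: "prog \<Rightarrow> store \<Rightarrow> nat \<Rightarrow> store \<Rightarrow> bool" where
  exec_Skip: "exec Skip s 1 s"
| exec_Assign: "exec (Assign x e) s 1 (s\<lparr>reg := (reg s)(x := aval e s)\<rparr>)"
| exec_Write: "exec (Write a i e) s 1
     (s\<lparr>arr := (arr s)(a := (arr s a)(aval i s := aval e s))\<rparr>)"
| exec_Seq: "exec P s t s' \<Longrightarrow> exec Q s' t' s'' \<Longrightarrow> exec (Seq P Q) s (t + t') s''"
| exec_IfTrue: "bval b s \<Longrightarrow> exec P s t s' \<Longrightarrow> exec (If b P Q) s (Suc t) s'"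
| exec_IfFalse: "\<not> bval b s \<Longrightarrow> exec Q s t s' \<Longrightarrow> exec (If b P Q) s (Suc t) s'"
| exec_WhileFalse: "\<not> bval b s \<Longrightarrow> exec (While b P) s 1 s"
| exec_WhileTrue: "bval b s \<Longrightarrow> exec P s t s' \<Longrightarrow> exec (While b P) s' t' s'' \<Longrightarrow>
     exec (While b P) s (Suc (t + t')) s''"

text \<open>
  Input: a graph with vertices \<open>0, \<dots>, n - 1\<close> as adjacency lists. Register 0 holds \<open>n\<close>; the
  neighbours of \<open>v\<close> are listed without repetition, in any order, in array 1 at the positions
  from \<open>arr s 0 v\<close> up to but excluding \<open>arr s 0 (v + 1)\<close>. All other memory is arbitrary.
\<close>

definition adjacency_input :: "nat \<Rightarrow> nat set set \<Rightarrow> store \<Rightarrow> bool" where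
  "adjacency_input n E s \<longleftrightarrow>
     reg s 0 = n \<and> arr s 0 0 = 0 \<and>
     (\<forall>v<n. arr s 0 v \<le> arr s 0 (Suc v) \<and>
        bij_betw (arr s 1) {arr s 0 v..<arr s 0 (Suc v)} {w. {v, w} \<in> E})"

text \<open>Output: array 2 holds parent pointers, with a root pointing to itself.\<close>

definition parent_output :: "nat \<Rightarrow> store \<Rightarrow> nat set set" where
  "parent_output n s = {{v, arr s 2 v} | v. v < n \<and> arr s 2 v \<noteq> v}"

text \<open>
  The running time bound \<open>O(\<delta>|E|)\<close> is rendered with \<open>\<delta> + 1\<close> and \<open>|E| + 1\<close>, because a program
  needs time to read its input also if \<open>\<delta> = 0\<close> (trees, for instance) and takes at least one step
  also if \<open>|E| = 0\<close>. For \<open>|E| \<ge> 1\<close> and \<open>\<delta> \<ge> 1/2\<close>, the least positive value a hyperbolicity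
  constant can have, this is at most \<open>6C\<delta>|E|\<close>. The program is not given \<open>\<delta>\<close>.
\<close>

definition constructs_ecc_approx_trees :: "prog \<Rightarrow> real \<Rightarrow> bool" where
  "constructs_ecc_approx_trees P C \<longleftrightarrow>
     (\<forall>n E \<delta> s. connected_graph {..<n} E \<and> hyperbolic {..<n} E \<delta> \<and> adjacency_input n E s \<longrightarrow>
        (\<exists>t s'. exec P s t s' \<and>
           real t \<le> C * ((\<delta> + 1) * (real (card E) + 1)) \<and>
           ecc_approx_spanning_tree {..<n} E (4 * \<delta> + 1) (parent_output n s')))"

end

(* Let x, y be mutually distant with middle vertex c, and let D be their distance. The four-point
   condition for x, y, c, w gives d(c,w) <= max(d(x,w), d(y,w)) - floor(D/2) + 2 delta. For w = v this
   bounds d(c,v) by ecc(v) - floor(D/2) + 2 delta; for w furthest from c it bounds ecc(c) by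
   ceil(D/2) + 2 delta. Adding up, ecc_T(v) <= d(c,v) + ecc(c) <= ecc(v) + 4 delta + 1.

   A mutually distant pair is found by repeated BFS, each time from a vertex furthest from the previous
   source, until the eccentricity stops growing. A furthest vertex has eccentricity at least the
   diameter minus 2 delta, so the eccentricity can grow at most 2 delta times after the first round. *)

theory Submission
  imports Defs
begin

section \<open>Distances and BFS trees\<close>

text \<open>The tree bound needs any mutually distant pair, not a diametral one, so the stopping
  test compares eccentricities only: \<delta> enters the count of searches but not the program. As
  eccentricities are integers, the growth is at most floor(2\<delta>). One further round brings the
  source close to the maximum and one detects that growth has ended; with the initial search and the
  final one from c this makes at most floor(2\<delta>) + 4 searches. Each costs O(|V| + |E|), and
  connectedness turns |V| into |E| + 1. The machine cannot halve, but the last search is rooted at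
  one end of the pair, so its parent pointers trace a shortest path from the other end, and
  comparing twice the distance with d(x,y) locates the middle. Correctness, termination and time are
  proved together: every loop invariant carries a budget that pays for the work still to be
  done.\<close>

lemma walk_mono: "walk V T u p v \<Longrightarrow> T \<subseteq> E \<Longrightarrow> walk V E u p v"
  unfolding walk_def by (auto elim: successively_mono)

lemma walk_single: "u \<in> V \<Longrightarrow> walk V E u [u] u"
  by (simp add: walk_def)

lemma walk_append:
  assumes "walk V E u p v" "walk V E v q w"
  shows "walk V E u (p @ tl q) w"
proof (cases "tl q = []")
  case True
  then show ?thesis using assms unfolding walk_def by (cases q) auto
next
  case False
  \<comment> \<open>\<open>remdups_adj.cases\<close> splits lists into those with zero, one, or at
    least two elements.\<close>
  then obtain a b r where q: "q = a # b # r" by (cases q rule: remdups_adj.cases) auto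
  then show ?thesis using assms unfolding walk_def
    by (auto simp: successively_append_iff)
qed

lemma walk_rev: "walk V E u p v \<Longrightarrow> walk V E v (rev p) u"
  unfolding walk_def by (auto simp: hd_rev last_rev insert_commute)

lemma walk_snoc:
  "walk V E u p v \<Longrightarrow> {v, w} \<in> E \<Longrightarrow> w \<in> V \<Longrightarrow> walk V E u (p @ [w]) w"
  unfolding walk_def by (auto simp: successively_append_iff)

lemma gdist_le: "walk V E u p v \<Longrightarrow> gdist V E u v \<le> length p - 1"
  unfolding gdist_def
  by (rule Least_le, rule exI[of _ p]) (cases p, auto simp: walk_def)

section \<open>The shortest-path metric and eccentricities\<close>

locale conn_graph =
  fixes V :: "'a set" and E :: "'a set set"
  assumes conn: "connected_graph V E"
begin

abbreviation "d \<equiv> gdist V E"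

lemma fin: "finite V" and ne: "V \<noteq> {}"
  using conn by (auto simp: connected_graph_def simple_graph_def)

lemma edgeD: "{u, v} \<in> E \<Longrightarrow> u \<in> V \<and> v \<in> V \<and> u \<noteq> v"
  using conn unfolding connected_graph_def simple_graph_def
  by (cases "u = v") fastforce+

lemma finE: "finite E"
proof -
  have "E \<subseteq> Pow V" using conn by (auto simp: connected_graph_def simple_graph_def)
  then show ?thesis using fin finite_subset by blast
qed

lemma shortest_path_ex:
  assumes "u \<in> V" "v \<in> V"
  obtains p where "shortest_path V E u p v"
proof -
  obtain p where p: "walk V E u p v" using conn assms unfolding connected_graph_def by blast
  then have "length p = Suc (length p - 1)" unfolding walk_def by (cases p) auto
  with p have "\<exists>k p. walk V E u p v \<and> length p = Suc k" by blast
  then have "\<exists>p. walk V E u p v \<and> length p = Suc (d u v)"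
    unfolding gdist_def by (rule LeastI_ex)
  then show ?thesis using that unfolding shortest_path_def by blast
qed

lemma d_triangle:
  assumes "u \<in> V" "v \<in> V" "w \<in> V"
  shows "d u w \<le> d u v + d v w"
proof -
  obtain p where p: "shortest_path V E u p v" using assms shortest_path_ex by blast
  obtain q where q: "shortest_path V E v q w" using assms shortest_path_ex by blast
  have "walk V E u (p @ tl q) w" using p q walk_append unfolding shortest_path_def by metis
  from gdist_le[OF this] show ?thesis using p q unfolding shortest_path_def by simp
qed

lemma d_sym:
  assumes "u \<in> V" "v \<in> V"
  shows "d u v = d v u"
proof -
  have le: "d u v \<le> d v u" if uv: "u \<in> V" "v \<in> V" for u v
  proof -
    obtain p where p: "shortest_path V E v p u" using shortest_path_ex uv by blast
    then have "walk V E u (rev p) v" using walk_rev[of V E v p u] unfolding shortest_path_def by simp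
    from gdist_le[OF this] show ?thesis using p unfolding shortest_path_def by simp
  qed
  show ?thesis using le assms by (simp add: le_antisym)
qed

lemma d_self [simp]: "u \<in> V \<Longrightarrow> d u u = 0"
  using gdist_le[OF walk_single, of u V E] by simp

lemma d_eq_0: "u \<in> V \<Longrightarrow> v \<in> V \<Longrightarrow> d u v = 0 \<longleftrightarrow> u = v"
proof
  assume "u \<in> V" "v \<in> V" "d u v = 0"
  then obtain p where "walk V E u p v" "length p = 1"
    using shortest_path_ex unfolding shortest_path_def by (metis One_nat_def)
  then show "u = v" unfolding walk_def by (cases p) auto
qed simp

lemma d_edge:
  assumes "{v, w} \<in> E" "u \<in> V"
  shows "d u w \<le> Suc (d u v)"
proof -
  have vw: "v \<in> V" "w \<in> V" using edgeD assms by auto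
  have "d v w \<le> 1" using gdist_le[OF walk_snoc[OF walk_single[OF vw(1)] assms(1) vw(2)]] by simp
  then show ?thesis using d_triangle[OF assms(2) vw] by simp
qed

text \<open>The penultimate vertex of a shortest path does it: cutting off \<open>v\<close> gives
  one inequality, \<open>d_edge\<close> the other. Inductions on the distance from \<open>c\<close>
  rest on this.\<close>

lemma d_pred:
  assumes "c \<in> V" "v \<in> V" "v \<noteq> c"
  obtains u where "{v, u} \<in> E" "Suc (d c u) = d c v"
proof -
  obtain p where p: "walk V E c p v" "length p = Suc (d c v)"
    using assms shortest_path_ex unfolding shortest_path_def by metis
  from p obtain q where q: "p = q @ [v]"
    unfolding walk_def by (metis append_butlast_last_id)
  have "q \<noteq> []" using p assms unfolding q walk_def by auto
  then obtain r u where r: "q = r @ [u]" by (metis append_butlast_last_id)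
  have w: "walk V E c q u" and e: "{v, u} \<in> E" using p unfolding q r walk_def
    by (auto simp: successively_append_iff insert_commute hd_append split: if_splits)
  have "Suc (d c u) \<le> d c v" using gdist_le[OF w] p(2) \<open>q \<noteq> []\<close> unfolding q
    by (cases q) auto
  moreover have "d c v \<le> Suc (d c u)" using e assms d_edge by (simp add: insert_commute)
  ultimately show ?thesis using that e by simp
qed

lemma d_le_ecc: "u \<in> V \<Longrightarrow> d v u \<le> ecc V E v"
  unfolding ecc_def using fin by auto

lemma ecc_le: "(\<And>u. u \<in> V \<Longrightarrow> d v u \<le> k) \<Longrightarrow> ecc V E v \<le> k"
  unfolding ecc_def using fin ne by auto

lemma ecc_attained: obtains u where "u \<in> V" "d v u = ecc V E v"
proof -
  have "ecc V E v \<in> d v ` V" unfolding ecc_def using fin ne by (intro Max_in) auto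
  then show ?thesis using that by auto
qed

lemma subgraph_dist:
  assumes "T \<subseteq> E" "connected_graph V T" "u \<in> V" "v \<in> V"
  shows "d u v \<le> gdist V T u v"
proof -
  interpret T: conn_graph V T by unfold_locales fact
  obtain p where "shortest_path V T u p v" using T.shortest_path_ex assms by blast
  then show ?thesis using gdist_le[OF walk_mono[OF _ assms(1)], of V u p v] unfolding shortest_path_def by simp
qed

text \<open>Cutting the path at \<open>c\<close> gives two walks of total length
  \<open>d x y\<close>; the triangle inequality excludes anything shorter.\<close>

lemma shortest_path_dist_sum:
  assumes p: "shortest_path V E x p y" and c: "c \<in> set p"
  shows "c \<in> V" "d x c + d c y = d x y"
proof -
  have w: "walk V E x p y" and l: "length p = Suc (d x y)" using p by (auto simp: shortest_path_def)
  show cV: "c \<in> V" using w c unfolding walk_def by auto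
  obtain q r where qr: "p = q @ c # r" using c by (meson split_list)
  have w1: "walk V E x (q @ [c]) c" and w2: "walk V E c (c # r) y"
    using w unfolding qr walk_def
    by (auto simp: successively_append_iff hd_append split: if_splits)
  have xy: "x \<in> V" "y \<in> V" using w unfolding walk_def by (auto dest: hd_in_set last_in_set)
  have "d x c + d c y \<le> d x y" using gdist_le[OF w1] gdist_le[OF w2] l unfolding qr by simp
  then show "d x c + d c y = d x y" using d_triangle[OF xy(1) cV xy(2)] by simp
qed

end

text \<open>Only two local properties of the parent function are required, so the tree lemmas serve
  both a choice function and the array filled by the machine.\<close>

locale bfs_parents = conn_graph +
  fixes c and par
  assumes c: "c \<in> V"
    and par_edge: "\<And>v. v \<in> V \<Longrightarrow> v \<noteq> c \<Longrightarrow> {v, par v} \<in> E"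
    and par_dist: "\<And>v. v \<in> V \<Longrightarrow> v \<noteq> c \<Longrightarrow> Suc (d c (par v)) = d c v"
begin

definition "T = {{v, par v} | v. v \<in> V \<and> v \<noteq> c}"

lemma T_sub: "T \<subseteq> E" unfolding T_def using par_edge by auto

text \<open>A parent is strictly nearer to \<open>c\<close> than its child, so the distances decide
  which end of a tree edge is the parent.\<close>

lemma T_edgeD:
  assumes "{u, v} \<in> T" "d c u \<le> d c v"
  shows "u = par v"
proof -
  obtain w where "{u, v} = {w, par w}" "w \<in> V" "w \<noteq> c" using assms unfolding T_def by auto
  then show ?thesis using assms(2) par_dist[of w] by (auto simp: doubleton_eq_iff)
qed

lemma T_walk: "v \<in> V \<Longrightarrow> \<exists>p. walk V T c p v \<and> length p = Suc (d c v)"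
proof (induction "d c v" arbitrary: v)
  case 0
  then have "v = c" using c d_eq_0 by metis
  then show ?case using c walk_single by fastforce
next
  case (Suc k)
  then have vc: "v \<noteq> c" using c by auto
  then have pv: "par v \<in> V" using par_edge edgeD Suc.prems by blast
  obtain p where p: "walk V T c p (par v)" "length p = Suc (d c (par v))"
    using Suc(1)[OF _ pv] par_dist[OF Suc.prems vc] Suc(2) by auto
  have "{par v, v} \<in> T" unfolding T_def using Suc.prems vc by (auto simp: insert_commute)
  from walk_snoc[OF p(1) this Suc.prems] show ?case using p(2) par_dist[OF Suc.prems vc] by fastforce
qed

lemma T_connected: "connected_graph V T"
proof -
  have "\<exists>p. walk V T u p v" if uv: "u \<in> V" "v \<in> V" for u v
  proof -
    obtain p where p: "walk V T c p u" using T_walk[OF uv(1)] by blast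
    obtain q where q: "walk V T c q v" using T_walk[OF uv(2)] by blast
    from walk_append[OF walk_rev[OF p] q] show ?thesis by blast
  qed
  then show ?thesis using conn T_sub unfolding connected_graph_def simple_graph_def by blast
qed

text \<open>Both cycle neighbours of a cycle vertex furthest from \<open>c\<close> would be its parent.\<close>

lemma T_acyclic: "\<not> is_cycle V T p"
proof
  assume cyc: "is_cycle V T p"
  define k where "k = length p - 1"
  have k: "k \<ge> 3" "length p = Suc k" using cyc unfolding is_cycle_def k_def by auto
  have ends: "p ! 0 = p ! k" using cyc k unfolding is_cycle_def walk_def
    by (metis diff_Suc_1 hd_conv_nth last_conv_nth)
  have inj: "p ! i \<noteq> p ! j" if "i \<in> {1..k}" "j \<in> {1..k}" "i \<noteq> j" for i j
  proof -
    have "tl p ! (i - 1) \<noteq> tl p ! (j - 1)"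
      using cyc that k unfolding is_cycle_def by (subst nth_eq_iff_index_eq) auto
    then show ?thesis using that k by (auto simp: nth_tl Suc_le_eq)
  qed
  have edge: "{p ! i, p ! Suc i} \<in> T" if "i < k" for i
    using cyc that k unfolding is_cycle_def walk_def by (simp add: successively_conv_nth)
  define m where "m = Max ((\<lambda>i. d c (p ! i)) ` {1..k})"
  have "m \<in> (\<lambda>i. d c (p ! i)) ` {1..k}" unfolding m_def using k by (intro Max_in) auto
  then obtain i where i: "i \<in> {1..k}" "d c (p ! i) = m" by auto
  have max: "d c (p ! j) \<le> d c (p ! i)" if "j \<in> {1..k}" for j
    unfolding i(2) m_def using that by auto
  \<comment> \<open>The cyclic neighbours of position \<open>i\<close>, each cycle vertex being
    counted once by \<open>1..k\<close>; they differ because \<open>k \<ge> 3\<close>.\<close>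
  define a where "a = (if i = 1 then k else i - 1)"
  define b where "b = (if i = k then 1 else Suc i)"
  have ab: "a \<in> {1..k}" "b \<in> {1..k}" "a \<noteq> b" unfolding a_def b_def using i k by auto
  have "{p ! a, p ! i} \<in> T"
    using edge[of "i - 1"] i ends unfolding a_def by auto
  then have 1: "p ! a = par (p ! i)" using T_edgeD max ab by blast
  have "{p ! b, p ! i} \<in> T"
    using edge[of i] edge[of 0] i ends k unfolding b_def by (auto simp: insert_commute)
  then have "p ! b = par (p ! i)" using T_edgeD max ab by blast
  with 1 show False using inj ab by metis
qed

lemma bfs_tree_T: "bfs_tree V E c T"
proof -
  have "gdist V T c v = d c v" if v: "v \<in> V" for v
  proof -
    obtain p where p: "walk V T c p v" "length p = Suc (d c v)" using T_walk[OF v] by blast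
    show ?thesis using subgraph_dist[OF T_sub T_connected c v] gdist_le[OF p(1)] p(2) by simp
  qed
  then show ?thesis unfolding bfs_tree_def spanning_tree_def is_tree_def
    using T_sub T_connected T_acyclic by blast
qed

text \<open>The edge from a vertex to its parent determines the vertex as its deeper end. This lets
  costs proportional to the number of vertices be charged to the edges.\<close>

lemma card_V_le: "card V \<le> Suc (card E)"
proof -
  have "inj_on (\<lambda>v. {v, par v}) (V - {c})"
  proof (rule inj_onI)
    fix v w assume vw: "v \<in> V - {c}" "w \<in> V - {c}" "{v, par v} = {w, par w}"
    then show "v = w" using par_dist[of v] par_dist[of w] by (auto simp: doubleton_eq_iff)
  qed
  then have "card (V - {c}) \<le> card E"
    using par_edge finE by (intro card_inj_on_le[where f = "\<lambda>v. {v, par v}"]) auto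
  then show ?thesis using c by simp
qed

end

context conn_graph
begin

lemma bfs_parents_ex:
  assumes "c \<in> V"
  shows "\<exists>par. bfs_parents V E c par"
proof -
  have "\<forall>v. \<exists>u. v \<in> V \<and> v \<noteq> c \<longrightarrow> {v, u} \<in> E \<and> Suc (d c u) = d c v"
    using d_pred[OF assms] by metis
  then obtain par where "\<forall>v. v \<in> V \<and> v \<noteq> c \<longrightarrow> {v, par v} \<in> E \<and> Suc (d c (par v)) = d c v"
    by metis
  then have "bfs_parents V E c par" using assms by unfold_locales auto
  then show ?thesis by blast
qed

lemma card_V_le_Suc_card_E: "card V \<le> Suc (card E)"
proof -
  obtain c where "c \<in> V" using ne by blast
  then obtain par where "bfs_parents V E c par" using bfs_parents_ex by blast
  then show ?thesis by (rule bfs_parents.card_V_le)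
qed

text \<open>Removing edges cannot shorten distances. Conversely, the tree route from
  \<open>v\<close> to \<open>u\<close> through \<open>c\<close> consists of two legs that keep their
  length in the tree.\<close>

lemma bfs_tree_ecc:
  assumes T: "bfs_tree V E c T" and cV: "c \<in> V" and v: "v \<in> V"
  shows "ecc V E v \<le> ecc V T v" "ecc V T v \<le> d c v + ecc V E c"
proof -
  have T': "T \<subseteq> E" "connected_graph V T" and dT: "\<And>v. v \<in> V \<Longrightarrow> gdist V T c v = d c v"
    using T unfolding bfs_tree_def spanning_tree_def is_tree_def by auto
  interpret T: conn_graph V T by unfold_locales fact
  show "ecc V E v \<le> ecc V T v"
    using subgraph_dist[OF T' v] T.d_le_ecc by (intro ecc_le) (meson le_trans)
  show "ecc V T v \<le> d c v + ecc V E c"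
  proof (rule T.ecc_le)
    fix u assume u: "u \<in> V"
    have "T.d v u \<le> T.d v c + T.d c u" using T.d_triangle v cV u by blast
    also have "\<dots> = d c v + d c u" using dT[OF u] dT[OF v] T.d_sym[OF v cV] by simp
    finally show "T.d v u \<le> d c v + ecc V E c" using d_le_ecc[OF u, of c] by linarith
  qed
qed

end

section \<open>Hyperbolicity\<close>

text \<open>If \<open>a\<close> is the largest entry, the middle one is the maximum of the others;
  if not, the bound holds without the nonnegative gap. This replaces sorting by an inequality that
  linear arithmetic can use.\<close>

lemma sort3_gap:
  fixes a b c :: nat
  shows "real a \<le> max (real b) (real c) + (real (sort [a, b, c] ! 2) - real (sort [a, b, c] ! 1))"
  by (cases "a \<le> b"; cases "b \<le> c"; cases "a \<le> c"; simp add: numeral_2_eq_2)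

lemma four_point:
  assumes "hyperbolic V E \<delta>" "u \<in> V" "v \<in> V" "w \<in> V" "x \<in> V"
  shows "real (gdist V E u v + gdist V E w x) \<le>
    max (real (gdist V E u w + gdist V E v x)) (real (gdist V E u x + gdist V E v w)) + 2 * \<delta>"
  using assms sort3_gap[of "gdist V E u v + gdist V E w x" "gdist V E u w + gdist V E v x"
    "gdist V E u x + gdist V E v w"]
  unfolding hyperbolic_def Let_def by fastforce

locale hyp_graph = conn_graph +
  fixes \<delta> :: real
  assumes hyp: "hyperbolic V E \<delta>"
begin

lemma delta_nonneg: "\<delta> \<ge> 0"
proof -
  obtain u where u: "u \<in> V" using ne by blast
  from four_point[OF hyp u u u u] u show ?thesis by simp
qed

lemma middle_ecc:
  assumes V: "x \<in> V" "y \<in> V" "c \<in> V" "v \<in> V"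
    and ex: "ecc V E x \<le> d x y" and ey: "ecc V E y \<le> d x y"
    and c: "d x c + d c y = d x y" and m: "min (d x c) (d y c) = d x y div 2"
  shows "real (d c v + ecc V E c) \<le> real (ecc V E v) + 4 * \<delta> + 1"
proof -
  have cy: "d y c = d c y" using d_sym V by simp
  define h where "h = d x y div 2"
  \<comment> \<open>Either end may be the one nearer to \<open>c\<close>, so each distance is
    bounded only by the larger half.\<close>
  have half: "d x c \<le> d x y - h" "d c y \<le> d x y - h" "d x y \<le> 2 * h + 1" "h \<le> d x y"
    using c m unfolding cy h_def by linarith+
  have near: "real (d c w) \<le> real k - real h + 2 * \<delta>"
    if w: "w \<in> V" and k: "d x w \<le> k" "d y w \<le> k" for w k
  proof -
    have "real (d x y + d c w) \<le> max (real (d x c + d y w)) (real (d x w + d y c)) + 2 * \<delta>"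
      using four_point[OF hyp] V w by blast
    moreover have "real (d x c + d y w) \<le> real (d x y) - real h + real k"
      "real (d x w + d y c) \<le> real (d x y) - real h + real k"
      using half k cy by linarith+
    ultimately show ?thesis by linarith
  qed
  have 1: "real (d c v) \<le> real (ecc V E v) - real h + 2 * \<delta>"
    using near[OF V(4)] d_le_ecc d_sym V by metis
  obtain w where w: "w \<in> V" "d c w = ecc V E c" using ecc_attained by blast
  have "d x w \<le> d x y" "d y w \<le> d x y" using w(1) d_le_ecc ex ey by (meson le_trans)+
  from near[OF w(1) this] have "real (ecc V E c) \<le> real (d x y) - real h + 2 * \<delta>" using w by simp
  \<comment> \<open>The sum exceeds \<open>ecc V E v\<close> by at most
    \<open>d x y - 2 * h + 4 * \<delta>\<close>; the additive 1 is the rounding of half of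
    \<open>d x y\<close>.\<close>
  with 1 half show ?thesis by linarith
qed

text \<open>With \<open>z\<close> furthest from \<open>w\<close>, the four-point condition bounds
  \<open>d u v + d w z\<close>. Each competing sum has one term at most \<open>d u v\<close> and the
  other at most the eccentricity of \<open>v\<close>, so \<open>d u v\<close> cancels.\<close>

lemma ecc_furthest:
  assumes V: "u \<in> V" "v \<in> V" "w \<in> V" and uv: "d u v = ecc V E u"
  shows "real (ecc V E w) \<le> real (ecc V E v) + 2 * \<delta>"
proof -
  obtain z where z: "z \<in> V" "d w z = ecc V E w" using ecc_attained by blast
  have "real (d u v + d w z) \<le> max (real (d u w + d v z)) (real (d u z + d v w)) + 2 * \<delta>"
    using four_point[OF hyp] V z by blast
  moreover have "d u w \<le> d u v" "d u z \<le> d u v" "d v z \<le> ecc V E v" "d v w \<le> ecc V E v"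
    using d_le_ecc V z uv by auto
  ultimately show ?thesis using z(2) by linarith
qed

lemma bfs_tree_middle:
  assumes "x \<in> V" "y \<in> V" "c \<in> V"
    and "ecc V E x \<le> d x y" "ecc V E y \<le> d x y"
    and "d x c + d c y = d x y" "min (d x c) (d y c) = d x y div 2"
    and T: "bfs_tree V E c T" and v: "v \<in> V"
  shows "real (ecc V T v) \<le> real (ecc V E v) + 4 * \<delta> + 1"
  using middle_ecc[OF assms(1-3) v assms(4-7)] bfs_tree_ecc(2)[OF T assms(3) v] by linarith

lemma mutually_distant_bfs:
  assumes md: "mutually_distant V E x y" and p: "shortest_path V E x p y"
    and m: "middle_vertex V E x p y c" and T: "bfs_tree V E c T" and v: "v \<in> V"
  shows "ecc V E v \<le> ecc V T v" "real (ecc V T v) \<le> real (ecc V E v) + 4 * \<delta> + 1"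
proof -
  have V: "x \<in> V" "y \<in> V" and e: "ecc V E x = d x y" "ecc V E y = d x y"
    using md d_sym unfolding mutually_distant_def furthest_def by auto
  have c: "c \<in> set p" "min (d x c) (d y c) = d x y div 2"
    using m unfolding middle_vertex_def by auto
  note cs = shortest_path_dist_sum[OF p c(1)]
  show "ecc V E v \<le> ecc V T v" using bfs_tree_ecc(1)[OF T cs(1) v] .
  show "real (ecc V T v) \<le> real (ecc V E v) + 4 * \<delta> + 1"
    using bfs_tree_middle[OF V cs(1) _ _ cs(2) c(2) T v] e by simp
qed

text \<open>A diametral pair is mutually distant, which settles existence without any
  search.\<close>

lemma mutually_distant_ex: "\<exists>x y. mutually_distant V E x y"
proof -
  obtain x where x: "x \<in> V" "\<And>z. z \<in> V \<Longrightarrow> ecc V E z \<le> ecc V E x"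
  proof -
    have "Max (ecc V E ` V) \<in> ecc V E ` V" using fin ne by (intro Max_in) auto
    then obtain x where "x \<in> V" "ecc V E x = Max (ecc V E ` V)" by auto
    then show ?thesis using that fin by simp
  qed
  obtain y where y: "y \<in> V" "d x y = ecc V E x" using ecc_attained by blast
  have "ecc V E y = d x y" using x(2)[OF y(1)] d_le_ecc[OF x(1), of y] d_sym[OF x(1) y(1)] y(2) by simp
  then have "mutually_distant V E x y"
    using x y d_sym unfolding mutually_distant_def furthest_def by auto
  then show ?thesis by blast
qed

lemma middle_vertex_ex:
  assumes p: "shortest_path V E x p y"
  shows "\<exists>c. middle_vertex V E x p y c"
proof -
  define k where "k = d x y div 2"
  have w: "walk V E x p y" and l: "length p = Suc (d x y)" using p by (auto simp: shortest_path_def)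
  have k: "k < length p" using l unfolding k_def by simp
  define c where "c = p ! k"
  have cp: "c \<in> set p" using k unfolding c_def by simp
  note cs = shortest_path_dist_sum[OF p cp]
  have w1: "walk V E x (take (Suc k) p) c" and w2: "walk V E c (drop k p) y"
    using w k unfolding c_def walk_def
    by (auto simp: hd_drop_conv_nth last_conv_nth successively_conv_nth min_def le_Suc_eq
        dest: in_set_takeD in_set_dropD)
  have xy: "x \<in> V" "y \<in> V" using w unfolding walk_def by (auto dest: hd_in_set last_in_set)
  have "d x c \<le> k" "d c y \<le> d x y - k" using gdist_le[OF w1] gdist_le[OF w2] l k by auto
  \<comment> \<open>Neither upper bound can be strict, since the two distances add up to
    \<open>d x y\<close>.\<close>
  then have "d x c = k" "d c y = d x y - k" using cs(2) unfolding k_def by linarith+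
  then have "min (d x c) (d y c) = d x y div 2" using d_sym[OF cs(1) xy(2)] unfolding k_def by auto
  then show ?thesis using cp unfolding middle_vertex_def by blast
qed

lemma ecc_approx_ex: "\<exists>T. ecc_approx_spanning_tree V E (4 * \<delta> + 1) T"
proof -
  obtain x y where md: "mutually_distant V E x y" using mutually_distant_ex by blast
  then have "x \<in> V" "y \<in> V" unfolding mutually_distant_def furthest_def by auto
  then obtain p where p: "shortest_path V E x p y" using shortest_path_ex by blast
  obtain c where c: "middle_vertex V E x p y c" using middle_vertex_ex[OF p] by blast
  then have "c \<in> V" using shortest_path_dist_sum[OF p] unfolding middle_vertex_def by blast
  then obtain par where "bfs_parents V E c par" using bfs_parents_ex by blast
  from bfs_parents.bfs_tree_T[OF this] obtain T where T: "bfs_tree V E c T" ..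
  have "spanning_tree V E T" using T unfolding bfs_tree_def by blast
  then show ?thesis using mutually_distant_bfs(2)[OF md p c T] unfolding ecc_approx_spanning_tree_def
    by (auto simp: algebra_simps)
qed

end

section \<open>Time-bounded weakest preconditions\<close>

text \<open>\<open>k\<close> is a time budget; the postcondition also constrains the budget that is left.\<close>

definition wp :: "prog \<Rightarrow> (store \<Rightarrow> nat \<Rightarrow> bool) \<Rightarrow> store \<Rightarrow> nat \<Rightarrow> bool" where
  "wp P Q s k \<longleftrightarrow> (\<exists>t s'. exec P s t s' \<and> t \<le> k \<and> Q s' (k - t))"

lemma wp_mono: "wp P Q s k \<Longrightarrow> (\<And>s' k'. Q s' k' \<Longrightarrow> R s' k') \<Longrightarrow> wp P R s k"
  unfolding wp_def by blast

inductive_simps exec_Skip_iff: "exec Skip s t s'"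
inductive_simps exec_Assign_iff: "exec (Assign x e) s t s'"
inductive_simps exec_Write_iff: "exec (Write a i e) s t s'"
inductive_cases exec_SeqE: "exec (Seq P Q) s t s'"
inductive_cases exec_IfE: "exec (If b P Q) s t s'"

lemma wp_Skip: "wp Skip Q s k \<longleftrightarrow> k > 0 \<and> Q s (k - 1)"
  by (auto simp: wp_def exec_Skip_iff Suc_le_eq)

lemma wp_Assign:
  "wp (Assign x e) Q s k \<longleftrightarrow> k > 0 \<and> Q (s\<lparr>reg := (reg s)(x := aval e s)\<rparr>) (k - 1)"
  by (auto simp: wp_def exec_Assign_iff Suc_le_eq)

lemma wp_Write:
  "wp (Write a i e) Q s k \<longleftrightarrow>
    k > 0 \<and> Q (s\<lparr>arr := (arr s)(a := (arr s a)(aval i s := aval e s))\<rparr>) (k - 1)"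
  by (auto simp: wp_def exec_Write_iff Suc_le_eq)

lemma wp_Seq: "wp (Seq P Q) R s k \<longleftrightarrow> wp P (wp Q R) s k"
proof
  assume "wp (Seq P Q) R s k"
  then obtain t t' s' s'' where "exec P s t s'" "exec Q s' t' s''" "t + t' \<le> k" "R s'' (k - (t + t'))"
    unfolding wp_def by (auto elim!: exec_SeqE)
  then show "wp P (wp Q R) s k" unfolding wp_def
    by (intro exI[of _ t] exI[of _ s'] exI[of _ t'] exI[of _ s''] conjI) auto
next
  assume "wp P (wp Q R) s k"
  then obtain t t' s' s'' where h: "exec P s t s'" "exec Q s' t' s''" "t \<le> k" "t' \<le> k - t" "R s'' (k - t - t')"
    unfolding wp_def by blast
  then show "wp (Seq P Q) R s k" unfolding wp_def
    by (intro exI[of _ "t + t'"] exI[of _ s''] conjI) (auto intro: exec_Seq)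
qed

lemma wp_If: "wp (If b P Q) R s k \<longleftrightarrow> k > 0 \<and> wp (if bval b s then P else Q) R s (k - 1)"
proof
  assume "wp (If b P Q) R s k"
  then obtain t s' where "exec (If b P Q) s t s'" "t \<le> k" "R s' (k - t)" unfolding wp_def by blast
  then show "k > 0 \<and> wp (if bval b s then P else Q) R s (k - 1)" unfolding wp_def
    by (elim exec_IfE) (auto intro!: exI[of _ s'] exI[of _ "t - 1"])
next
  assume h: "k > 0 \<and> wp (if bval b s then P else Q) R s (k - 1)"
  then obtain t s' where "exec (if bval b s then P else Q) s t s'" "t \<le> k - 1" "R s' (k - 1 - t)"
    unfolding wp_def by blast
  with h show "wp (If b P Q) R s k" unfolding wp_def
    by (intro exI[of _ "Suc t"] exI[of _ s'] conjI) (auto intro: exec_IfTrue exec_IfFalse split: if_splits)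
qed

text \<open>Every step uses up budget, so no separate termination measure is needed.\<close>

lemma wp_While:
  assumes "I s k"
    and step: "\<And>s k. I s k \<Longrightarrow> bval b s \<Longrightarrow> k > 0 \<and> wp P I s (k - 1)"
    and exit: "\<And>s k. I s k \<Longrightarrow> \<not> bval b s \<Longrightarrow> k > 0 \<and> Q s (k - 1)"
  shows "wp (While b P) Q s k"
  using assms(1)
proof (induction k arbitrary: s rule: less_induct)
  case (less k)
  show ?case
  proof (cases "bval b s")
    case False
    with exit[OF less.prems] show ?thesis unfolding wp_def
      by (intro exI[of _ 1] exI[of _ s]) (auto intro: exec_WhileFalse simp del: One_nat_def)
  next
    case True
    from step[OF less.prems True] obtain t s' where k: "k > 0" and
      e: "exec P s t s'" "t \<le> k - 1" "I s' (k - 1 - t)" unfolding wp_def by blast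
    then have "k - 1 - t < k" by simp
    from less.IH[OF this e(3)] obtain t' s'' where
      "exec (While b P) s' t' s''" "t' \<le> k - 1 - t" "Q s'' (k - 1 - t - t')" unfolding wp_def by blast
    then show ?thesis unfolding wp_def using k e True
      by (intro exI[of _ "Suc (t + t')"] exI[of _ s''] conjI) (auto intro: exec_WhileTrue)
  qed
qed

lemmas wp_simps = wp_Skip wp_Assign wp_Write wp_Seq wp_If

section \<open>The state of a breadth-first search\<close>

context conn_graph
begin

text \<open>The list \<open>q\<close> is never popped: it holds all visited vertices in order of
  discovery, and those before the head \<open>h\<close> have been scanned. \<open>A\<close> is
  shifted by one so that 0 can mean unvisited. Sortedness and the last conjunct say that the entries
  from the head on span at most two consecutive levels.\<close>

definition bfs_state :: "'a \<Rightarrow> 'a list \<Rightarrow> nat \<Rightarrow> ('a \<Rightarrow> nat) \<Rightarrow> ('a \<Rightarrow> 'a) \<Rightarrow> bool" where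
  "bfs_state c q h A par \<longleftrightarrow>
     distinct q \<and> c \<in> set q \<and> set q \<subseteq> V \<and> h \<le> length q \<and>
     (\<forall>v\<in>V. A v = (if v \<in> set q then Suc (d c v) else 0)) \<and>
     par c = c \<and> (\<forall>v\<in>set q. v \<noteq> c \<longrightarrow> {v, par v} \<in> E \<and> Suc (d c (par v)) = d c v) \<and>
     sorted (map (d c) q) \<and>
     (\<forall>i<h. \<forall>w. {q ! i, w} \<in> E \<longrightarrow> w \<in> set q) \<and>
     (h < length q \<longrightarrow> (\<forall>v\<in>set q. d c v \<le> Suc (d c (q ! h))))"

lemma bfs_state_init:
  assumes "c \<in> V" "\<And>v. v \<in> V \<Longrightarrow> A v = (if v = c then 1 else 0)" "par c = c"
  shows "bfs_state c [c] 0 A par"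
  using assms unfolding bfs_state_def by auto

text \<open>By induction the predecessor of \<open>u\<close> is visited. Being strictly nearer than
  the head, it precedes the head in the sorted queue, so it has been scanned and its neighbours,
  \<open>u\<close> among them, are visited.\<close>

lemma bfs_state_near:
  assumes st: "bfs_state c q h A par" and h: "h < length q" and u: "u \<in> V"
    and le: "d c u \<le> d c (q ! h)"
  shows "u \<in> set q"
  using u le
proof (induction "d c u" arbitrary: u)
  case 0
  then show ?case using st d_eq_0[of c u] unfolding bfs_state_def by auto
next
  case (Suc m)
  have cV: "c \<in> V" using st unfolding bfs_state_def by blast
  have "u \<noteq> c" using Suc(2) cV by auto
  then obtain z where z: "{u, z} \<in> E" "Suc (d c z) = d c u" using d_pred[OF cV Suc.prems(1)] by blast
  have "z \<in> set q" using Suc(1)[of z] z Suc(2) Suc.prems edgeD[OF z(1)] by simp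
  then obtain i where i: "i < length q" "q ! i = z" by (auto simp: in_set_conv_nth)
  have "i < h"
  proof (rule ccontr)
    assume "\<not> i < h"
    then have "d c (q ! h) \<le> d c (q ! i)"
      using st i sorted_nth_mono[of "map (d c) q" h i] unfolding bfs_state_def by simp
    then show False using z(2) i(2) Suc.prems(2) by simp
  qed
  then show ?case using st z(1) i(2) unfolding bfs_state_def by (metis insert_commute)
qed

text \<open>The edge puts \<open>w\<close> at most one level below the head, and
  \<open>bfs_state_near\<close> excludes the level of the head and all above it. Hence the new label
  is exact and appending keeps the order.\<close>

lemma bfs_state_visit:
  assumes st: "bfs_state c q h A par" and h: "h < length q"
    and e: "{q ! h, w} \<in> E" and w: "w \<notin> set q"
  shows "bfs_state c (q @ [w]) h (A(w := Suc (A (q ! h)))) (par(w := q ! h))"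
proof -
  have cV: "c \<in> V" and cq: "c \<in> set q" and hq: "q ! h \<in> set q" and hV: "q ! h \<in> V"
    using st h unfolding bfs_state_def by auto
  have wV: "w \<in> V" using edgeD[OF e] by blast
  have "d c w \<le> Suc (d c (q ! h))" using d_edge[OF e cV] .
  moreover have "\<not> d c w \<le> d c (q ! h)" using bfs_state_near[OF st h wV] w by blast
  ultimately have dw: "d c w = Suc (d c (q ! h))" by simp
  have near: "\<forall>v\<in>set q. d c v \<le> Suc (d c (q ! h))" using st h unfolding bfs_state_def by blast
  show ?thesis unfolding bfs_state_def
  proof (intro conjI)
    show "sorted (map (d c) (q @ [w]))"
      using st near dw unfolding bfs_state_def by (simp add: sorted_append)
    show "\<forall>v\<in>V. (A(w := Suc (A (q ! h)))) v = (if v \<in> set (q @ [w]) then Suc (d c v) else 0)"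
      using st hq hV dw unfolding bfs_state_def by auto
    show "\<forall>v\<in>set (q @ [w]). v \<noteq> c \<longrightarrow>
        {v, (par(w := q ! h)) v} \<in> E \<and> Suc (d c ((par(w := q ! h)) v)) = d c v"
      using st e dw w unfolding bfs_state_def by (auto simp: insert_commute)
    show "\<forall>i<h. \<forall>x. {(q @ [w]) ! i, x} \<in> E \<longrightarrow> x \<in> set (q @ [w])"
      using st h unfolding bfs_state_def by (auto simp: nth_append)
    show "h < length (q @ [w]) \<longrightarrow> (\<forall>v\<in>set (q @ [w]). d c v \<le> Suc (d c ((q @ [w]) ! h)))"
      using near dw h by (auto simp: nth_append)
  qed (use st w wV cq in \<open>auto simp: bfs_state_def\<close>)
qed

lemma bfs_state_advance:
  assumes st: "bfs_state c q h A par" and h: "h < length q"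
    and nb: "\<And>w. {q ! h, w} \<in> E \<Longrightarrow> w \<in> set q"
  shows "bfs_state c q (Suc h) A par"
proof -
  have "d c (q ! h) \<le> d c (q ! Suc h)" if "Suc h < length q"
    using st that sorted_nth_mono[of "map (d c) q" h "Suc h"] unfolding bfs_state_def by simp
  then have "Suc h < length q \<longrightarrow> (\<forall>v\<in>set q. d c v \<le> Suc (d c (q ! Suc h)))"
    using st h unfolding bfs_state_def by (meson Suc_le_mono le_trans)
  then show ?thesis using st h nb unfolding bfs_state_def by (auto simp: less_Suc_eq)
qed

text \<open>The visited set contains \<open>c\<close> and is closed under adjacency, so it is
  everything; by sortedness its last entry is furthest from \<open>c\<close>.\<close>

lemma bfs_state_done:
  assumes st: "bfs_state c q (length q) A par"
  shows "set q = V" "ecc V E c = d c (last q)" "bfs_parents V E c par"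
proof -
  have cV: "c \<in> V" and cq: "c \<in> set q" and qV: "set q \<subseteq> V" using st unfolding bfs_state_def by auto
  have closed: "w \<in> set q" if "v \<in> set q" "{v, w} \<in> E" for v w
    using st that unfolding bfs_state_def by (metis in_set_conv_nth)
  have "u \<in> set q" if "u \<in> V" for u
    using that
  proof (induction "d c u" arbitrary: u)
    case 0
    then show ?case using cq d_eq_0[OF cV] by metis
  next
    case (Suc m)
    then have "u \<noteq> c" using cV by auto
    then obtain z where z: "{u, z} \<in> E" "Suc (d c z) = d c u" using d_pred[OF cV Suc.prems] by blast
    have "z \<in> set q" using Suc(1)[of z] z Suc(2) edgeD[OF z(1)] by simp
    then show ?case using closed[of z u] z by (simp add: insert_commute)
  qed
  then show qV: "set q = V" using qV by auto
  have ne: "q \<noteq> []" using cq by auto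
  show "ecc V E c = d c (last q)"
  proof (rule antisym)
    show "ecc V E c \<le> d c (last q)"
    proof (rule ecc_le)
      fix u assume "u \<in> V"
      then obtain i where i: "i < length q" "q ! i = u" using qV by (metis in_set_conv_nth)
      then show "d c u \<le> d c (last q)"
        using st ne sorted_nth_mono[of "map (d c) q" i "length q - 1"]
        unfolding bfs_state_def by (simp add: last_conv_nth)
    qed
    show "d c (last q) \<le> ecc V E c" using d_le_ecc ne qV by (metis last_in_set)
  qed
  show "bfs_parents V E c par" using st cV qV unfolding bfs_state_def by unfold_locales auto
qed

end

section \<open>Breadth-first search on the machine\<close>

text \<open>Array 3 starts with arbitrary contents and later holds labels of the previous
  search.\<close>

definition bfs_clear :: prog where
  "bfs_clear = Seq (Assign 4 (Num 0))
     (While (Less (Reg 4) (Reg 0))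
       (Seq (Write 3 (Reg 4) (Num 0)) (Assign 4 (Plus (Reg 4) (Num 1)))))"

text \<open>Register 4 runs through the adjacency list of the vertex in register 5; register 6 is
  the neighbour at hand.\<close>

definition bfs_scan :: prog where
  "bfs_scan = While (Less (Reg 4) (Read 0 (Plus (Reg 5) (Num 1))))
     (Seq (Assign 6 (Read 1 (Reg 4)))
     (Seq (If (Less (Read 3 (Reg 6)) (Num 1))
            (Seq (Write 3 (Reg 6) (Plus (Read 3 (Reg 5)) (Num 1)))
            (Seq (Write 2 (Reg 6) (Reg 5))
            (Seq (Write 4 (Reg 3) (Reg 6))
                 (Assign 3 (Plus (Reg 3) (Num 1))))))
            Skip)
          (Assign 4 (Plus (Reg 4) (Num 1)))))"

text \<open>On exit register 5 still holds the vertex scanned last, which is a furthest vertex from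
  the source; the next search starts there.\<close>

definition bfs_loop :: prog where
  "bfs_loop = While (Less (Reg 2) (Reg 3))
     (Seq (Assign 5 (Read 4 (Reg 2)))
     (Seq (Assign 4 (Read 0 (Reg 5)))
     (Seq bfs_scan
          (Assign 2 (Plus (Reg 2) (Num 1))))))"

text \<open>Register 1 holds the source, registers 2 and 3 the head and the tail of the queue in array 4,
  register 5 the vertex being scanned. Array 3 holds the distance from the source plus one,
  and 0 for unvisited vertices.\<close>

definition bfs :: prog where
  "bfs = Seq bfs_clear
     (Seq (Write 3 (Reg 1) (Num 1))
     (Seq (Write 2 (Reg 1) (Reg 1))
     (Seq (Write 4 (Num 0) (Reg 1))
     (Seq (Assign 2 (Num 0))
     (Seq (Assign 3 (Num 1))
          bfs_loop)))))"

text \<open>Besides the input and the source, a search must preserve registers 7 and 8, which carry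
  data from one search to the next.\<close>

definition frame :: "store \<Rightarrow> store \<Rightarrow> bool" where
  "frame s0 s \<longleftrightarrow> reg s 0 = reg s0 0 \<and> reg s 1 = reg s0 1 \<and> reg s 7 = reg s0 7 \<and> reg s 8 = reg s0 8 \<and>
     arr s 0 = arr s0 0 \<and> arr s 1 = arr s0 1"

definition queue :: "store \<Rightarrow> nat list" where
  "queue s = map (arr s 4) [0..<reg s 3]"

lemma length_queue [simp]: "length (queue s) = reg s 3"
  by (simp add: queue_def)

lemma nth_queue [simp]: "i < reg s 3 \<Longrightarrow> queue s ! i = arr s 4 i"
  by (simp add: queue_def)

section \<open>Correctness and cost of a single search\<close>

lemma bfs_clear_wp:
  assumes "k0 + 3 * reg s0 0 + 2 \<le> k"
  shows "wp bfs_clear (\<lambda>s k. frame s0 s \<and> (\<forall>v<reg s0 0. arr s 3 v = 0) \<and> k0 \<le> k) s0 k"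
proof -
  \<comment> \<open>Three units per round: test, write, increment. The extra 1 pays for the failing
    test.\<close>
  define I where "I = (\<lambda>s k. frame s0 s \<and> reg s 4 \<le> reg s0 0 \<and> (\<forall>v<reg s 4. arr s 3 v = 0) \<and>
    k0 + 1 + 3 * (reg s0 0 - reg s 4) \<le> k)"
  show ?thesis unfolding bfs_clear_def wp_simps
  proof (intro conjI wp_While[where I = I])
    show "I (s0\<lparr>reg := (reg s0)(4 := aval (Num 0) s0)\<rparr>) (k - 1)"
      using assms unfolding I_def frame_def by auto
  qed (use assms in \<open>auto simp: I_def wp_simps frame_def less_Suc_eq\<close>)
qed

locale ram_graph = conn_graph "{..<n}" E for n :: nat and E +
  fixes s0 :: store
  assumes input: "adjacency_input n E s0"
begin

abbreviation "off \<equiv> arr s0 0"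

lemma reg0: "reg s0 0 = n"
  using input unfolding adjacency_input_def by simp

lemma off_mono: "v < n \<Longrightarrow> off v \<le> off (Suc v)"
  using input unfolding adjacency_input_def by simp

lemma neighbours: "v < n \<Longrightarrow> arr s0 1 ` {off v..<off (Suc v)} = {w. {v, w} \<in> E}"
  using input unfolding adjacency_input_def bij_betw_def by simp

text \<open>Handshake count: an ordered adjacent pair is determined by its edge and the bit telling
  whether the first end is the smaller one.\<close>

lemma sum_degrees: "(\<Sum>v<n. off (Suc v) - off v) \<le> 2 * card E"
proof -
  define S where "S = (SIGMA v:{..<n}. {w. {v, w} \<in> E})"
  have fw: "finite {w. {v, w} \<in> E}" for v
    by (rule finite_subset[OF _ fin]) (use edgeD in blast)
  have "off (Suc v) - off v = card {w. {v, w} \<in> E}" if "v < n" for v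
    using input that bij_betw_same_card unfolding adjacency_input_def by fastforce
  then have "(\<Sum>v<n. off (Suc v) - off v) = card S"
    unfolding S_def using fw by (simp add: card_SigmaI)
  also have "\<dots> \<le> card (E \<times> (UNIV :: bool set))"
  proof (rule card_inj_on_le[where f = "\<lambda>(v, w). ({v, w}, v < w)"])
    show "inj_on (\<lambda>(v, w). ({v, w}, v < w)) S"
      by (auto simp: inj_on_def S_def doubleton_eq_iff)
    show "(\<lambda>(v, w). ({v, w}, v < w)) ` S \<subseteq> E \<times> UNIV" unfolding S_def by auto
  qed (use finE in auto)
  finally show ?thesis by (simp add: card_cartesian_product)
qed

lemma bfs_scan_wp:
  assumes st: "bfs_state c (queue s) h (arr s 3) (arr s 2)" and fr: "frame s0 s"
    and h: "reg s 2 = h" "h < reg s 3" "reg s 5 = queue s ! h" "reg s 4 = off (reg s 5)"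
    and k: "k0 + 1 + 8 * (off (Suc (reg s 5)) - off (reg s 5)) \<le> k"
  shows "wp bfs_scan (\<lambda>s' k'. bfs_state c (queue s') (Suc h) (arr s' 3) (arr s' 2) \<and> frame s0 s' \<and>
    reg s' 2 = h \<and> h < reg s' 3 \<and> reg s' 5 = queue s' ! h \<and> take h (queue s') = take h (queue s) \<and>
    reg s' 5 = reg s 5 \<and> k0 \<le> k') s k"
proof -
  define v where "v = reg s 5"
  \<comment> \<open>A newly visited neighbour costs 8 units, one already visited only 5. That
    \<open>take h\<close> stays fixed is for the outer loop, whose budget depends on the set of
    scanned vertices.\<close>
  define I where "I = (\<lambda>s' k'. bfs_state c (queue s') h (arr s' 3) (arr s' 2) \<and> frame s0 s' \<and>
    reg s' 2 = h \<and> h < reg s' 3 \<and> reg s' 5 = v \<and> queue s' ! h = v \<and>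
    take h (queue s') = take h (queue s) \<and>
    off v \<le> reg s' 4 \<and> reg s' 4 \<le> off (Suc v) \<and> (\<forall>j\<in>{off v..<reg s' 4}. arr s0 1 j \<in> set (queue s')) \<and>
    k0 + 1 + 8 * (off (Suc v) - reg s' 4) \<le> k')"
  have "v \<in> set (queue s)" using h nth_mem[of h "queue s"] by (simp add: v_def)
  then have vn: "v < n" using st unfolding bfs_state_def by auto
  show ?thesis unfolding bfs_scan_def
  proof (rule wp_While[where I = I])
    show "I s k" unfolding I_def using assms off_mono[OF vn] by (auto simp: v_def)
  next
    fix s' k' assume I: "I s' k'" and nb: "\<not> bval (Less (Reg 4) (Read 0 (Plus (Reg 5) (Num 1)))) s'"
    then have j: "reg s' 4 = off (Suc v)" unfolding I_def frame_def by auto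
    have "w \<in> set (queue s')" if "{queue s' ! h, w} \<in> E" for w
    proof -
      have "w \<in> arr s0 1 ` {off v..<off (Suc v)}" using neighbours[OF vn] that I unfolding I_def by auto
      then show ?thesis using I j unfolding I_def by auto
    qed
    then have "bfs_state c (queue s') (Suc h) (arr s' 3) (arr s' 2)"
      using I unfolding I_def by (intro bfs_state_advance) auto
    then show "0 < k' \<and> bfs_state c (queue s') (Suc h) (arr s' 3) (arr s' 2) \<and> frame s0 s' \<and>
      reg s' 2 = h \<and> h < reg s' 3 \<and> reg s' 5 = queue s' ! h \<and> take h (queue s') = take h (queue s) \<and>
      reg s' 5 = reg s 5 \<and> k0 \<le> k' - 1"
      using I unfolding I_def v_def by auto
  next
    fix s' k' assume I: "I s' k'" and b: "bval (Less (Reg 4) (Read 0 (Plus (Reg 5) (Num 1)))) s'"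
    define j where "j = reg s' 4"
    define w where "w = arr s0 1 j"
    have fr: "frame s0 s'" and st: "bfs_state c (queue s') h (arr s' 3) (arr s' 2)"
      and h: "reg s' 2 = h" "h < reg s' 3" "reg s' 5 = v" "queue s' ! h = v" "arr s' 4 h = v"
      using I unfolding I_def by auto
    have j: "off v \<le> j" "j < off (Suc v)" using I b unfolding I_def frame_def j_def by auto
    have k: "k0 + 9 + 8 * (off (Suc v) - Suc j) \<le> k'" using I j unfolding I_def j_def[symmetric] by auto
    have w1: "arr s' (Suc 0) j = w" using fr unfolding frame_def w_def by simp
    have e: "{v, w} \<in> E" using neighbours[OF vn] j unfolding w_def by auto
    then have wn: "w < n" using edgeD by auto
    have old: "arr s' 3 w < 1 \<longleftrightarrow> w \<notin> set (queue s')" using st wn unfolding bfs_state_def by auto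
    have scanned: "arr s0 1 i \<in> set (queue s')" if "off v \<le> i" "i < j" for i
      using I that unfolding I_def j_def by auto
    show "0 < k' \<and> wp (Seq (Assign 6 (Read 1 (Reg 4)))
     (Seq (If (Less (Read 3 (Reg 6)) (Num 1))
            (Seq (Write 3 (Reg 6) (Plus (Read 3 (Reg 5)) (Num 1)))
            (Seq (Write 2 (Reg 6) (Reg 5))
            (Seq (Write 4 (Reg 3) (Reg 6))
                 (Assign 3 (Plus (Reg 3) (Num 1))))))
            Skip)
          (Assign 4 (Plus (Reg 4) (Num 1))))) I s' (k' - 1)"
    proof (cases "w \<in> set (queue s')")
      case True
      define s1 where "s1 = s'\<lparr>reg := (reg s')(6 := w, 4 := Suc j)\<rparr>"
      have q: "queue s1 = queue s'" unfolding s1_def queue_def by simp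
      have "I s1 (k' - 5)" unfolding I_def q
        using I k j scanned True unfolding I_def s1_def frame_def w_def j_def
        by (auto simp: less_Suc_eq)
      \<comment> \<open>The constant is put in unary to match the successive subtractions of 1 made
        by the \<open>wp\<close> rules.\<close>
      then have "I s1 (k' - Suc (Suc (Suc (Suc (Suc 0)))))" by (simp add: eval_nat_numeral)
      then show ?thesis using k old True unfolding s1_def
        by (simp add: wp_simps j_def[symmetric] w1)
    next
      case False
      define s1 where "s1 = s'\<lparr>arr := (arr s')(3 := (arr s' 3)(w := Suc (arr s' 3 v)),
          2 := (arr s' 2)(w := v), 4 := (arr s' 4)(reg s' 3 := w)),
        reg := (reg s')(6 := w, 3 := Suc (reg s' 3), 4 := Suc j)\<rparr>"
      have q: "queue s1 = queue s' @ [w]" unfolding s1_def queue_def by simp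
      have st1: "bfs_state c (queue s1) h (arr s1 3) (arr s1 2)"
        using bfs_state_visit[OF st _ _ False] h e unfolding q by (simp add: s1_def)
      have fr1: "frame s0 s1" using fr unfolding frame_def s1_def by simp
      have r1: "reg s1 2 = h" "reg s1 3 = Suc (reg s' 3)" "reg s1 4 = Suc j" "reg s1 5 = v"
        using h unfolding s1_def by auto
      have "take h (queue s1) = take h (queue s)" "queue s1 ! h = v"
        using I h(2,4) unfolding q I_def by (auto simp: nth_append)
      moreover have "\<forall>i\<in>{off v..<Suc j}. arr s0 1 i \<in> set (queue s1)"
        using scanned unfolding q by (auto simp: less_Suc_eq w_def)
      ultimately have "I s1 (k' - 8)"
        using st1 fr1 k j h(2) unfolding I_def r1 by auto
      then have "I s1 (k' - Suc (Suc (Suc (Suc (Suc (Suc (Suc (Suc 0))))))))" by (simp add: eval_nat_numeral)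
      then show ?thesis using k old False unfolding s1_def
        by (simp add: wp_simps j_def[symmetric] w1 h)
    qed
  qed
qed

end

text \<open>Stepping back through predecessors realises every distance from 0 to
  \<open>d c v\<close>. This bounds the length of the climb to the middle.\<close>

lemma (in conn_graph) d_less_card:
  assumes "c \<in> V" "v \<in> V"
  shows "d c v < card V"
proof -
  have "{..d c v} \<subseteq> d c ` V"
    using assms(2)
  proof (induction "d c v" arbitrary: v)
    case 0
    then show ?case by force
  next
    case (Suc m)
    then have "v \<noteq> c" using assms(1) by auto
    then obtain u where u: "{v, u} \<in> E" "Suc (d c u) = d c v" using d_pred[OF assms(1) Suc.prems] by blast
    have "{..d c u} \<subseteq> d c ` V" using Suc(1)[of u] u Suc(2) edgeD[OF u(1)] by simp
    moreover have "{..d c v} = insert (d c v) {..d c u}" using u(2) by auto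
    ultimately show ?case using Suc.prems by simp
  qed
  from card_mono[OF _ this] have "Suc (d c v) \<le> card (d c ` V)" using fin by simp
  then show ?thesis using card_image_le[OF fin, of "d c"] by simp
qed

context ram_graph
begin

text \<open>\<open>bfs_parents\<close> leaves the parent of the root open, while
  \<open>parent_output\<close> recognises the root by its self-pointer.\<close>

definition bfs_post :: "nat \<Rightarrow> store \<Rightarrow> bool" where
  "bfs_post c s \<longleftrightarrow> (\<forall>v<n. arr s 3 v = Suc (d c v)) \<and> reg s 5 < n \<and> d c (reg s 5) = ecc {..<n} E c \<and>
     arr s 2 c = c \<and> bfs_parents {..<n} E c (arr s 2)"

lemma bfs_loop_wp:
  assumes fr: "frame s0 s" and st: "bfs_state c (queue s) 0 (arr s 3) (arr s 2)" and h: "reg s 2 = 0"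
    and k: "k0 + 1 + (\<Sum>v<n. 8 * (off (Suc v) - off v) + 5) \<le> k"
  shows "wp bfs_loop (\<lambda>s k. frame s0 s \<and> bfs_post c s \<and> k0 \<le> k) s k"
proof -
  \<comment> \<open>The budget reserved for unscanned vertices: 8 per neighbour, and 5 for the outer
    test, three assignments and the failing inner test.\<close>
  define cost where "cost = (\<lambda>U. \<Sum>v\<in>{..<n} - U. 8 * (off (Suc v) - off v) + 5)"
  define I where "I = (\<lambda>s k. frame s0 s \<and> bfs_state c (queue s) (reg s 2) (arr s 3) (arr s 2) \<and>
    (reg s 2 > 0 \<longrightarrow> reg s 5 = queue s ! (reg s 2 - 1)) \<and>
    k0 + 1 + cost (set (take (reg s 2) (queue s))) \<le> k)"
  show ?thesis unfolding bfs_loop_def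
  proof (rule wp_While[where I = I])
    show "I s k" using assms unfolding I_def cost_def by simp
  next
    fix s k assume I: "I s k" and nb: "\<not> bval (Less (Reg 2) (Reg 3)) s"
    then have st: "bfs_state c (queue s) (length (queue s)) (arr s 3) (arr s 2)"
      and h: "reg s 2 = reg s 3" unfolding I_def bfs_state_def by auto
    have q: "queue s \<noteq> []" using st unfolding bfs_state_def by auto
    then have l: "reg s 5 = last (queue s)" using I h unfolding I_def
      by (metis last_conv_nth length_greater_0_conv length_queue)
    note full = bfs_state_done[OF st]
    have "last (queue s) \<in> {..<n}" using q unfolding full(1)[symmetric] by simp
    moreover have "\<forall>v<n. arr s 3 v = Suc (d c v)" "arr s 2 c = c"
      using st full(1) unfolding bfs_state_def by auto
    ultimately have "bfs_post c s" unfolding bfs_post_def l using full by auto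
    then show "0 < k \<and> frame s0 s \<and> bfs_post c s \<and> k0 \<le> k - 1" using I unfolding I_def by auto
  next
    fix s k assume I: "I s k" and b: "bval (Less (Reg 2) (Reg 3)) s"
    define h where "h = reg s 2"
    define v where "v = arr s 4 h"
    define s1 where "s1 = s\<lparr>reg := (reg s)(5 := v, 4 := off v)\<rparr>"
    have hl: "h < reg s 3" using b unfolding h_def by simp
    have st: "bfs_state c (queue s) h (arr s 3) (arr s 2)" and fr: "frame s0 s"
      and k: "k0 + 1 + cost (set (take h (queue s))) \<le> k" using I unfolding I_def h_def by auto
    have q1: "queue s1 = queue s" unfolding s1_def queue_def by simp
    have vq: "v \<in> set (queue s)" using nth_mem[of h "queue s"] hl by (simp add: v_def)
    have vn: "v < n" using st vq unfolding bfs_state_def by auto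
    \<comment> \<open>Queue entries are distinct, so each vertex is paid for only once.\<close>
    have "v \<notin> set (take h (queue s))"
    proof
      assume "v \<in> set (take h (queue s))"
      then obtain i where "i < h" "queue s ! i = v" using hl by (auto simp: in_set_conv_nth)
      then show False using st hl unfolding v_def bfs_state_def
        by (metis length_queue less_trans nat_neq_iff nth_eq_iff_index_eq nth_queue)
    qed
    then have cost: "cost (set (take h (queue s))) =
      8 * (off (Suc v) - off v) + 5 + cost (insert v (set (take h (queue s))))"
      unfolding cost_def using vn by (subst sum.remove[of _ v]) (auto simp: Diff_insert[symmetric])
    have "wp bfs_scan (\<lambda>s' k'. bfs_state c (queue s') (Suc h) (arr s' 3) (arr s' 2) \<and> frame s0 s' \<and>
      reg s' 2 = h \<and> h < reg s' 3 \<and> reg s' 5 = queue s' ! h \<and> take h (queue s') = take h (queue s1) \<and>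
      reg s' 5 = reg s1 5 \<and> k0 + 2 + cost (insert v (set (take h (queue s)))) \<le> k') s1 (k - 1 - 1 - 1)"
    proof (rule bfs_scan_wp)
      show "bfs_state c (queue s1) h (arr s1 3) (arr s1 2)" using st unfolding q1 by (simp add: s1_def)
      show "frame s0 s1" using fr by (simp add: s1_def frame_def)
    qed (use hl k cost in \<open>auto simp: s1_def q1[unfolded s1_def] h_def[symmetric] v_def\<close>)
    then have "wp bfs_scan (wp (Assign 2 (Plus (Reg 2) (Num 1))) I) s1 (k - 1 - 1 - 1)"
    proof (rule wp_mono)
      fix s' k' assume h': "bfs_state c (queue s') (Suc h) (arr s' 3) (arr s' 2) \<and> frame s0 s' \<and>
        reg s' 2 = h \<and> h < reg s' 3 \<and> reg s' 5 = queue s' ! h \<and> take h (queue s') = take h (queue s1) \<and>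
        reg s' 5 = reg s1 5 \<and> k0 + 2 + cost (insert v (set (take h (queue s)))) \<le> k'"
      define s2 where "s2 = s'\<lparr>reg := (reg s')(2 := Suc h)\<rparr>"
      have q2: "queue s2 = queue s'" unfolding s2_def queue_def by simp
      have "queue s' ! h = v" using h' by (auto simp: s1_def)
      then have t: "set (take (Suc h) (queue s2)) = insert v (set (take h (queue s)))"
        using h' unfolding q2 q1 by (subst take_Suc_conv_app_nth) auto
      have "reg s2 2 = Suc h" by (simp add: s2_def)
      then have "I s2 (k' - 1)" using h' t unfolding I_def q2
        by (auto simp: s2_def frame_def q1)
      then show "wp (Assign 2 (Plus (Reg 2) (Num 1))) I s' k'"
        using h' by (simp add: wp_simps s2_def)
    qed
    then show "0 < k \<and> wp (Seq (Assign 5 (Read 4 (Reg 2))) (Seq (Assign 4 (Read 0 (Reg 5)))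
      (Seq bfs_scan (Assign 2 (Plus (Reg 2) (Num 1)))))) I s (k - 1)"
      using k cost fr unfolding wp_simps(4)
      by (simp add: wp_simps(2) s1_def h_def[symmetric] v_def frame_def)
  qed
qed

lemma bfs_wp:
  assumes c: "reg s0 1 < n" and k: "k0 + 24 * (card E + 1) \<le> k"
  shows "wp bfs (\<lambda>s k. frame s0 s \<and> bfs_post (reg s0 1) s \<and> k0 \<le> k) s0 k"
proof -
  let ?c = "reg s0 1"
  define cost where "cost = (\<Sum>v<n. 8 * (off (Suc v) - off v) + 5)"
  define m where "m = (\<Sum>v<n. off (Suc v) - off v)"
  have "cost = 8 * m + 5 * n"
    unfolding cost_def m_def by (simp add: sum.distrib sum_distrib_left)
  moreover have "n \<le> Suc (card E)" using card_V_le_Suc_card_E by simp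
  moreover have "m \<le> 2 * card E" unfolding m_def by (rule sum_degrees)
  \<comment> \<open>Scanning costs at most \<open>16 * card E + 5 * n\<close>, clearing
    \<open>3 * n + 2\<close>, and 6 covers the five initialising steps and the last loop test. With
    \<open>n \<le> card E + 1\<close> this stays below \<open>24 * (card E + 1)\<close>.\<close>
  ultimately have k: "k0 + cost + 6 + 3 * n + 2 \<le> k" using k by simp
  show ?thesis unfolding bfs_def wp_Seq
  proof (rule wp_mono[OF bfs_clear_wp])
    show "k0 + cost + 6 + 3 * reg s0 0 + 2 \<le> k" using k reg0 by simp
  next
    fix s k assume h: "frame s0 s \<and> (\<forall>v<reg s0 0. arr s 3 v = 0) \<and> k0 + cost + 6 \<le> k"
    define s1 where "s1 = s\<lparr>arr := (arr s)(3 := (arr s 3)(?c := 1), 2 := (arr s 2)(?c := ?c),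
      4 := (arr s 4)(0 := ?c)), reg := (reg s)(2 := 0, 3 := 1)\<rparr>"
    have q: "queue s1 = [?c]" unfolding s1_def queue_def by simp
    have "bfs_state ?c (queue s1) 0 (arr s1 3) (arr s1 2)"
      using h c reg0 unfolding q by (intro bfs_state_init) (auto simp: s1_def)
    then have "wp bfs_loop (\<lambda>s k. frame s0 s \<and> bfs_post ?c s \<and> k0 \<le> k) s1 (k - 1 - 1 - 1 - 1 - 1)"
      using h by (intro bfs_loop_wp) (auto simp: s1_def frame_def cost_def)
    moreover have "reg s (Suc 0) = ?c" using h unfolding frame_def by simp
    ultimately show "wp (Write 3 (Reg 1) (Num 1)) (wp (Write 2 (Reg 1) (Reg 1)) (wp (Write 4 (Num 0) (Reg 1))
      (wp (Assign 2 (Num 0)) (wp (Assign 3 (Num 1)) (wp bfs_loop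
        (\<lambda>s k. frame s0 s \<and> bfs_post ?c s \<and> k0 \<le> k)))))) s k"
      using h by (simp add: wp_simps s1_def)
  qed
qed

end

section \<open>The tree construction on the machine\<close>

text \<open>Register 8 holds the previous source and register 7 its eccentricity plus one,
  or 0 before the first round.\<close>

definition sweep :: prog where
  "sweep = While (Less (Reg 7) (Read 3 (Reg 5)))
     (Seq (Assign 7 (Read 3 (Reg 5)))
     (Seq (Assign 8 (Reg 1))
     (Seq (Assign 1 (Reg 5))
          bfs)))"

text \<open>With register 7 holding \<open>d(x,y) + 1\<close>, the guard says \<open>2 d(x,c) > d(x,y) + 1\<close>, so climbing
  from \<open>y\<close> towards the root \<open>x\<close> stops at distance \<open>\<lceil>d(x,y)/2\<rceil>\<close> from \<open>x\<close>.\<close>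

definition climb :: prog where
  "climb = While (Less (Plus (Reg 7) (Num 2)) (Plus (Read 3 (Reg 4)) (Read 3 (Reg 4))))
     (Assign 4 (Read 2 (Reg 4)))"

text \<open>After \<open>sweep\<close> the pair is in registers 1 and 8, and arrays 2 and 3 describe
  the search from register 1, so climbing from register 8 needs no new search.\<close>

definition ecc_tree :: prog where
  "ecc_tree = Seq (Assign 7 (Num 0))
     (Seq (Assign 1 (Num 0))
     (Seq bfs
     (Seq sweep
     (Seq (Assign 4 (Reg 8))
     (Seq climb
     (Seq (Assign 1 (Reg 4))
          bfs))))))"

section \<open>Correctness and cost of the whole construction\<close>

locale hyp_ram_graph = hyp_graph "{..<n}" E \<delta> for n :: nat and E and \<delta>
begin

definition ready :: "store \<Rightarrow> bool" where
  "ready s \<longleftrightarrow> adjacency_input n E s \<and> reg s 1 < n"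

text \<open>Unlike \<open>bfs_post\<close>, this refers to the current store alone, so that searches
  can be chained.\<close>

definition searched :: "store \<Rightarrow> bool" where
  "searched s \<longleftrightarrow> ready s \<and> (\<forall>v<n. arr s 3 v = Suc (d (reg s 1) v)) \<and> reg s 5 < n \<and>
     d (reg s 1) (reg s 5) = ecc {..<n} E (reg s 1) \<and>
     arr s 2 (reg s 1) = reg s 1 \<and> bfs_parents {..<n} E (reg s 1) (arr s 2)"

abbreviation "bfs_cost \<equiv> 24 * (card E + 1)"

lemma bfs_searched:
  assumes "ready s" "k0 + bfs_cost \<le> k"
  shows "wp bfs (\<lambda>s' k'. searched s' \<and> (\<forall>i\<in>{1, 7, 8}. reg s' i = reg s i) \<and> k0 \<le> k') s k"
proof -
  interpret ram_graph n E s
    using assms(1) unfolding ready_def by unfold_locales simp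
  show ?thesis
  proof (rule wp_mono[OF bfs_wp[OF _ assms(2)]])
    show "reg s 1 < n" using assms(1) unfolding ready_def by simp
    fix s' k' assume "frame s s' \<and> bfs_post (reg s 1) s' \<and> k0 \<le> k'"
    then show "searched s' \<and> (\<forall>i\<in>{1, 7, 8}. reg s' i = reg s i) \<and> k0 \<le> k'"
      using assms(1) unfolding frame_def bfs_post_def searched_def ready_def adjacency_input_def
      by auto
  qed
qed

text \<open>After the first round the source is furthest from another vertex, so its eccentricity is within
  \<open>2\<delta>\<close> of the maximum. Every later round but the last increases it.\<close>

lemma sweep_wp:
  assumes s: "searched s" "reg s 7 = 0"
    and k: "k0 + 1 + (bfs_cost + 4) * (nat \<lfloor>2 * \<delta>\<rfloor> + 2) \<le> k"
  shows "wp sweep (\<lambda>s k. searched s \<and> reg s 8 < n \<and> reg s 7 = Suc (d (reg s 8) (reg s 1)) \<and>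
    ecc {..<n} E (reg s 8) = d (reg s 8) (reg s 1) \<and> ecc {..<n} E (reg s 1) \<le> d (reg s 8) (reg s 1) \<and>
    k0 \<le> k) s k"
proof -
  let ?e = "ecc {..<n} E"
  define N where "N = nat \<lfloor>2 * \<delta>\<rfloor>"
  define D where "D = Max (?e ` {..<n})"
  have D: "?e v \<le> D" if "v < n" for v unfolding D_def using that by simp
  have "D \<in> ?e ` {..<n}" unfolding D_def using ne by (intro Max_in) auto
  then obtain z where z: "z < n" "D = ?e z" by auto
  \<comment> \<open>Both sides are natural numbers, so 2\<delta> may be rounded down to
    \<open>N\<close>.\<close>
  have far: "D \<le> ?e v + N" if "u < n" "v < n" "d u v = ?e u" for u v
    using ecc_furthest[of u v z] that z unfolding N_def by (simp; linarith)
  \<comment> \<open>The number of rounds still allowed. After the first round the eccentricity is at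
    least \<open>D - N\<close>; it can then increase up to \<open>D\<close>, and the additional 1
    pays for the round that finds no increase. The 4 added to \<open>bfs_cost\<close> is the test
    and three assignments.\<close>
  define left where "left = (\<lambda>s :: store. if reg s 7 = 0 then N + 2
    else if reg s 7 < Suc (?e (reg s 1)) then D + 1 - ?e (reg s 1) else 0)"
  define I where "I = (\<lambda>s k. searched s \<and>
    (reg s 7 \<noteq> 0 \<longrightarrow> reg s 8 < n \<and> reg s 7 = Suc (?e (reg s 8)) \<and> d (reg s 8) (reg s 1) = ?e (reg s 8)) \<and>
    k0 + 1 + (bfs_cost + 4) * left s \<le> k)"
  have guard: "bval (Less (Reg 7) (Read 3 (Reg 5))) s \<longleftrightarrow> reg s 7 < Suc (?e (reg s 1))" if "searched s" for s
    using that unfolding searched_def by simp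
  show ?thesis unfolding sweep_def
  proof (rule wp_While[where I = I])
    show "I s k" using assms unfolding I_def left_def N_def by simp
  next
    fix s k assume I: "I s k" and "\<not> bval (Less (Reg 7) (Read 3 (Reg 5))) s"
    \<comment> \<open>The current source is furthest from the previous one and has no larger
      eccentricity, so the two are mutually distant.\<close>
    then have "Suc (?e (reg s 1)) \<le> reg s 7" using guard unfolding I_def by simp
    then show "0 < k \<and> searched s \<and> reg s 8 < n \<and> reg s 7 = Suc (d (reg s 8) (reg s 1)) \<and>
      ?e (reg s 8) = d (reg s 8) (reg s 1) \<and> ?e (reg s 1) \<le> d (reg s 8) (reg s 1) \<and> k0 \<le> k - 1"
      using I unfolding I_def by auto
  next
    fix s k assume I: "I s k" and b: "bval (Less (Reg 7) (Read 3 (Reg 5))) s"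
    define x where "x = reg s 1"
    define y where "y = reg s 5"
    have sr: "searched s" using I unfolding I_def by blast
    have xy: "x < n" "y < n" "d x y = ?e x" "arr s 3 y = Suc (?e x)"
      using sr unfolding searched_def ready_def x_def y_def by auto
    have lt: "reg s 7 < Suc (?e x)" using b guard[OF sr] unfolding x_def by simp
    have exy: "?e x \<le> ?e y" using d_le_ecc[of x y] d_sym[of x y] xy by simp
    define s1 where "s1 = s\<lparr>reg := (reg s)(7 := Suc (?e x), 8 := x, 1 := y)\<rparr>"
    have "ready s1" using sr xy unfolding searched_def ready_def adjacency_input_def s1_def by simp
    define l where "l = (if ?e x < ?e y then D + 1 - ?e y else 0)"
    have "Suc l \<le> left s"
      using D[OF xy(1)] D[OF xy(2)] far[OF xy(1-3)] lt unfolding l_def left_def x_def by auto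
    then have "(bfs_cost + 4) * Suc l \<le> (bfs_cost + 4) * left s" by (rule mult_le_mono2)
    then have k: "k0 + 1 + (bfs_cost + 4) * l + bfs_cost + 4 \<le> k" using I unfolding I_def by simp
    have "wp bfs I s1 (k - 1 - 1 - 1 - 1)"
    proof (rule wp_mono[OF bfs_searched[OF \<open>ready s1\<close>]])
      show "k0 + 1 + (bfs_cost + 4) * l + bfs_cost \<le> k - 1 - 1 - 1 - 1" using k by simp
      fix s' k' assume h: "searched s' \<and> (\<forall>i\<in>{1, 7, 8}. reg s' i = reg s1 i) \<and>
        k0 + 1 + (bfs_cost + 4) * l \<le> k'"
      then have r: "reg s' 1 = y" "reg s' 7 = Suc (?e x)" "reg s' 8 = x" by (auto simp: s1_def)
      have "left s' = l" unfolding left_def r l_def by simp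
      then show "I s' k'" using h xy unfolding I_def r by simp
    qed
    then show "0 < k \<and> wp (Seq (Assign 7 (Read 3 (Reg 5))) (Seq (Assign 8 (Reg 1))
      (Seq (Assign 1 (Reg 5)) bfs))) I s (k - 1)"
      using k xy by (simp add: wp_simps s1_def x_def y_def)
  qed
qed

lemma climb_wp:
  fixes s :: store
  defines "x \<equiv> reg s 1" and "y \<equiv> reg s 4"
  assumes s: "searched s" "y < n" "reg s 7 = Suc (d x y)"
    and k: "k0 + 1 + 2 * d x y \<le> k"
  shows "wp climb (\<lambda>s' k'. arr s' = arr s \<and> reg s' 0 = reg s 0 \<and> reg s' 4 < n \<and>
    d x (reg s' 4) + d (reg s' 4) y = d x y \<and> min (d x (reg s' 4)) (d y (reg s' 4)) = d x y div 2 \<and>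
    k0 \<le> k') s k"
proof -
  \<comment> \<open>The vertex reached lies on a shortest path and has not passed the midpoint; a
    step costs a test and an assignment.\<close>
  define I where "I = (\<lambda>(s' :: store) k'. arr s' = arr s \<and> reg s' 0 = reg s 0 \<and> reg s' 7 = reg s 7 \<and> reg s' 4 < n \<and>
    d x (reg s' 4) + d (reg s' 4) y = d x y \<and> d x y \<le> 2 * d x (reg s' 4) \<and>
    k0 + 1 + 2 * d x (reg s' 4) \<le> k')"
  have xn: "x < n" and dist: "\<And>v. v < n \<Longrightarrow> arr s 3 v = Suc (d x v)"
    and par: "bfs_parents {..<n} E x (arr s 2)"
    using s unfolding searched_def ready_def x_def by auto
  interpret par: bfs_parents "{..<n}" E x "arr s 2" by (rule par)
  show ?thesis unfolding climb_def
  proof (rule wp_While[where I = I])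
    show "I s k" using s k unfolding I_def y_def by simp
  next
    fix s' k' assume I: "I s' k'"
      and "\<not> bval (Less (Plus (Reg 7) (Num 2)) (Plus (Read 3 (Reg 4)) (Read 3 (Reg 4)))) s'"
    \<comment> \<open>With the invariant this pins the distance from \<open>x\<close> to half of
      \<open>d x y\<close> rounded up, leaving the rounded-down half to \<open>y\<close>.\<close>
    then have "2 * d x (reg s' 4) \<le> d x y + 1" using dist s(3) unfolding I_def by auto
    moreover have "d y (reg s' 4) = d (reg s' 4) y" using I s(2) d_sym unfolding I_def by simp
    ultimately have "min (d x (reg s' 4)) (d y (reg s' 4)) = d x y div 2"
      using I unfolding I_def by linarith
    then show "0 < k' \<and> arr s' = arr s \<and> reg s' 0 = reg s 0 \<and> reg s' 4 < n \<and>
      d x (reg s' 4) + d (reg s' 4) y = d x y \<and> min (d x (reg s' 4)) (d y (reg s' 4)) = d x y div 2 \<and>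
      k0 \<le> k' - 1" using I unfolding I_def by auto
  next
    fix s' k' assume I: "I s' k'"
      and b: "bval (Less (Plus (Reg 7) (Num 2)) (Plus (Read 3 (Reg 4)) (Read 3 (Reg 4)))) s'"
    define v where "v = reg s' 4"
    define w where "w = arr s 2 v"
    have v: "v < n" "d x v + d v y = d x y" "k0 + 1 + 2 * d x v \<le> k'" and a: "arr s' = arr s"
      using I unfolding I_def v_def by auto
    \<comment> \<open>The slack of 2 is exactly what one step towards \<open>x\<close> takes off the
      doubled distance.\<close>
    have big: "d x y + 2 \<le> 2 * d x v" using b I dist[OF v(1)] s(3) unfolding I_def v_def by auto
    then have "v \<noteq> x" using xn by auto
    then have e: "{v, w} \<in> E" and dw: "Suc (d x w) = d x v"
      using par.par_edge[of v] par.par_dist[of v] v unfolding w_def by auto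
    have wn: "w < n" using edgeD[OF e] by simp
    have "d y w \<le> Suc (d y v)" using d_edge[OF e] s(2) by simp
    then have "d w y \<le> Suc (d v y)" using d_sym[of w y] d_sym[of v y] wn v(1) s(2) by simp
    moreover have "d x y \<le> d x w + d w y" using d_triangle[of x w y] xn wn s(2) by simp
    ultimately have "d x w + d w y = d x y" using v(2) dw by linarith
    then have "I (s'\<lparr>reg := (reg s')(4 := w)\<rparr>) (k' - 1 - 1)"
      using I wn big dw v(3) unfolding I_def by auto
    then show "0 < k' \<and> wp (Assign 4 (Read 2 (Reg 4))) I s' (k' - 1)"
      using v(3) dw by (simp add: wp_simps a w_def v_def)
  qed
qed

lemma ecc_tree_wp:
  assumes s: "adjacency_input n E s"
    and k: "112 * (card E + 1) + 28 * (card E + 1) * nat \<lfloor>2 * \<delta>\<rfloor> \<le> k"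
  shows "wp ecc_tree
    (\<lambda>s k. ecc_approx_spanning_tree {..<n} E (4 * \<delta> + 1) (parent_output n s)) s k"
proof -
  let ?e = "ecc {..<n} E"
  let ?Q = "\<lambda>s k. ecc_approx_spanning_tree {..<n} E (4 * \<delta> + 1) (parent_output n s)"
  define s1 where "s1 = s\<lparr>reg := (reg s)(7 := 0, 1 := 0)\<rparr>"
  \<comment> \<open>Budgets are set up backwards: \<open>k3\<close> pays for the two assignments
    around the climb and the final search, \<open>k2\<close> adds the climb, \<open>k1\<close> the
    sweep.\<close>
  define k3 where "k3 = bfs_cost + 2"
  define k2 where "k2 = k3 + 2 * (card E + 1) + 1"
  define k1 where "k1 = k2 + 1 + (bfs_cost + 4) * (nat \<lfloor>2 * \<delta>\<rfloor> + 2)"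
  have n: "n > 0" "n \<le> card E + 1" using ne card_V_le_Suc_card_E by auto
  have "ready s1" using s n unfolding ready_def adjacency_input_def s1_def by simp
  have "k1 + bfs_cost + 2 \<le> k"
  proof -
    define m where "m = card E + 1"
    have "bfs_cost + 4 \<le> 28 * m" "bfs_cost = 24 * m" "m \<ge> 1" unfolding m_def by auto
    moreover from this have "(bfs_cost + 4) * (nat \<lfloor>2 * \<delta>\<rfloor> + 2) \<le> 28 * m * (nat \<lfloor>2 * \<delta>\<rfloor> + 2)"
      by (intro mult_le_mono1)
    ultimately show ?thesis using k
      unfolding k1_def k2_def k3_def m_def[symmetric] by (simp add: algebra_simps)
  qed
  have last: "wp bfs ?Q s' k'" if r: "ready s'" and k': "bfs_cost \<le> k'" and xy: "x < n" "y < n"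
    and e: "?e x \<le> d x y" "?e y \<le> d x y" and m: "d x (reg s' 1) + d (reg s' 1) y = d x y"
      "min (d x (reg s' 1)) (d y (reg s' 1)) = d x y div 2" for s' k' x y
  proof (rule wp_mono[OF bfs_searched[OF r, of 0]])
    let ?c = "reg s' 1"
    show "0 + bfs_cost \<le> k'" using k' by simp
    fix s'' k'' assume "searched s'' \<and> (\<forall>i\<in>{1, 7, 8}. reg s'' i = reg s' i) \<and> 0 \<le> (k'' :: nat)"
    then have par: "bfs_parents {..<n} E ?c (arr s'' 2)" and root: "arr s'' 2 ?c = ?c" and c: "?c < n"
      unfolding searched_def ready_def by auto
    interpret par: bfs_parents "{..<n}" E ?c "arr s'' 2" by (rule par)
    \<comment> \<open>Every other parent is strictly nearer to the root, so no non-root vertex is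
      dropped from the output.\<close>
    have "arr s'' 2 v \<noteq> v \<longleftrightarrow> v \<noteq> ?c" if "v < n" for v
      using par.par_dist[of v] that root by force
    then have T: "parent_output n s'' = par.T" unfolding parent_output_def par.T_def by auto
    show "?Q s'' k''" unfolding T ecc_approx_spanning_tree_def
      using bfs_tree_middle[OF _ _ _ e m par.bfs_tree_T] par.bfs_tree_T xy c
      unfolding bfs_tree_def by (auto simp: add.assoc)
  qed
  have mid: "wp (Seq (Assign 4 (Reg 8)) (Seq climb (Seq (Assign 1 (Reg 4)) bfs))) ?Q s' k'"
    if s': "searched s'" and y: "reg s' 8 < n" and r7: "reg s' 7 = Suc (d (reg s' 8) (reg s' 1))"
      and e8: "?e (reg s' 8) = d (reg s' 8) (reg s' 1)"
      and e1: "?e (reg s' 1) \<le> d (reg s' 8) (reg s' 1)" and k': "k2 \<le> k'" for s' k'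
  proof -
    define x where "x = reg s' 1"
    define y where "y = reg s' 8"
    define s2 where "s2 = s'\<lparr>reg := (reg s')(4 := y)\<rparr>"
    have xn: "x < n" and adj: "adjacency_input n E s'" using s' unfolding searched_def ready_def x_def by auto
    have yn: "y < n" using y unfolding y_def .
    have sym: "d y x = d x y" using d_sym xn yn by simp
    have e: "?e x \<le> d x y" "?e y \<le> d x y"
      using e8 e1 unfolding x_def[symmetric] y_def[symmetric] sym by simp_all
    have r2: "reg s2 1 = x" "reg s2 4 = y" "reg s2 7 = Suc (d x y)"
      using r7 sym by (auto simp: s2_def x_def y_def)
    have "searched s2" using s' unfolding searched_def ready_def adjacency_input_def s2_def by simp
    have "d x y < n" using d_less_card[of x y] xn yn by simp
    have "wp climb (\<lambda>s3 k3'. arr s3 = arr s2 \<and> reg s3 0 = reg s2 0 \<and> reg s3 4 < n \<and>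
      d x (reg s3 4) + d (reg s3 4) y = d x y \<and> min (d x (reg s3 4)) (d y (reg s3 4)) = d x y div 2 \<and>
      k3 - 1 \<le> k3') s2 (k' - 1)"
      using climb_wp[OF \<open>searched s2\<close>, of "k3 - 1" "k' - 1"] yn \<open>d x y < n\<close> n k'
      unfolding r2 k2_def k3_def by simp
    then have "wp climb (wp (Seq (Assign 1 (Reg 4)) bfs) ?Q) s2 (k' - 1)"
    proof (rule wp_mono)
      fix s3 :: store and k3' assume h: "arr s3 = arr s2 \<and> reg s3 0 = reg s2 0 \<and> reg s3 4 < n \<and>
        d x (reg s3 4) + d (reg s3 4) y = d x y \<and> min (d x (reg s3 4)) (d y (reg s3 4)) = d x y div 2 \<and>
        k3 - 1 \<le> k3'"
      define s4 where "s4 = s3\<lparr>reg := (reg s3)(1 := reg s3 4)\<rparr>"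
      have "ready s4" using adj h unfolding ready_def adjacency_input_def s4_def s2_def by simp
      then have "wp bfs ?Q s4 (k3' - 1)"
        using h xn yn e by (intro last[of s4 _ x y]) (auto simp: s4_def k3_def)
      then show "wp (Seq (Assign 1 (Reg 4)) bfs) ?Q s3 k3'"
        using h by (simp add: wp_simps s4_def k3_def)
    qed
    then show ?thesis using k' unfolding wp_Seq
      by (simp add: wp_Assign s2_def y_def k2_def k3_def)
  qed
  have "wp bfs (wp (Seq sweep (Seq (Assign 4 (Reg 8)) (Seq climb (Seq (Assign 1 (Reg 4)) bfs)))) ?Q) s1 (k - 1 - 1)"
  proof (rule wp_mono[OF bfs_searched[OF \<open>ready s1\<close>]])
    show "k1 + bfs_cost \<le> k - 1 - 1" using \<open>k1 + bfs_cost + 2 \<le> k\<close> by simp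
    fix s' k' assume h: "searched s' \<and> (\<forall>i\<in>{1, 7, 8}. reg s' i = reg s1 i) \<and> k1 \<le> k'"
    then have "reg s' 7 = 0" by (simp add: s1_def)
    then show "wp (Seq sweep (Seq (Assign 4 (Reg 8)) (Seq climb (Seq (Assign 1 (Reg 4)) bfs)))) ?Q s' k'"
      unfolding wp_Seq[of sweep] using h mid unfolding k1_def
      by (intro wp_mono[OF sweep_wp[of s' k2 k']]) auto
  qed
  then show ?thesis using \<open>k1 + bfs_cost + 2 \<le> k\<close> unfolding ecc_tree_def
    by (simp add: wp_Seq[of "Assign _ _"] wp_Seq[of bfs] wp_Assign s1_def)
qed

end

lemma constructs_ecc_tree: "constructs_ecc_approx_trees ecc_tree 112"
  unfolding constructs_ecc_approx_trees_def
proof (intro allI impI)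
  fix n E \<delta> s
  assume h: "connected_graph {..<n} E \<and> hyperbolic {..<n} E \<delta> \<and> adjacency_input n E s"
  interpret hyp_ram_graph n E \<delta> using h by unfold_locales auto
  define N where "N = nat \<lfloor>2 * \<delta>\<rfloor>"
  define m where "m = card E + 1"
  from ecc_tree_wp[OF _ order.refl] h obtain t s' where t: "exec ecc_tree s t s'"
    "t \<le> 112 * m + 28 * m * N"
    "ecc_approx_spanning_tree {..<n} E (4 * \<delta> + 1) (parent_output n s')"
    unfolding wp_def N_def m_def by blast
  have N: "real N \<le> 2 * \<delta>" using delta_nonneg unfolding N_def by (simp add: of_nat_nat)
  have "real t \<le> 112 * real m + 28 * real m * real N" using t(2) by (metis of_nat_add of_nat_le_iff of_nat_mult of_nat_numeral)
  also have "\<dots> \<le> 112 * real m + 28 * real m * (2 * \<delta>)" using N by (intro add_left_mono mult_left_mono) auto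
  \<comment> \<open>The coefficient of \<delta> is only 56; the constant 112 is dictated by the
    searches made even when \<delta> = 0.\<close>
  also have "\<dots> \<le> 112 * ((\<delta> + 1) * real m)" using delta_nonneg by (simp add: algebra_simps)
  finally have "real t \<le> 112 * ((\<delta> + 1) * (real (card E) + 1))" unfolding m_def by (simp add: add.commute)
  then show "\<exists>t s'. exec ecc_tree s t s' \<and> real t \<le> 112 * ((\<delta> + 1) * (real (card E) + 1)) \<and>
    ecc_approx_spanning_tree {..<n} E (4 * \<delta> + 1) (parent_output n s')" using t by blast
qed

theorem theorem38:
  shows "(\<forall>(V :: 'a set) E \<delta>. connected_graph V E \<and> hyperbolic V E \<delta> \<longrightarrow>
            (\<forall>x y p c T. mutually_distant V E x y \<and> shortest_path V E x p y \<and>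
               middle_vertex V E x p y c \<and> bfs_tree V E c T \<longrightarrow>
               (\<forall>v\<in>V. ecc V E v \<le> ecc V T v \<and>
                  real (ecc V T v) \<le> real (ecc V E v) + 4 * \<delta> + 1)) \<and>
            (\<exists>T. ecc_approx_spanning_tree V E (4 * \<delta> + 1) T)) \<and>
         (\<exists>P C. constructs_ecc_approx_trees P C)"
proof (intro conjI allI impI)
  fix V :: "'a set" and E \<delta>
  assume "connected_graph V E \<and> hyperbolic V E \<delta>"
  then interpret hyp_graph V E \<delta> by unfold_locales auto
  show "\<exists>T. ecc_approx_spanning_tree V E (4 * \<delta> + 1) T" by (rule ecc_approx_ex)
  fix x y p c T
  assume "mutually_distant V E x y \<and> shortest_path V E x p y \<and>
    middle_vertex V E x p y c \<and> bfs_tree V E c T"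
  then show "\<forall>v\<in>V. ecc V E v \<le> ecc V T v \<and> real (ecc V T v) \<le> real (ecc V E v) + 4 * \<delta> + 1"
    using mutually_distant_bfs by blast
next
  show "\<exists>P C. constructs_ecc_approx_trees P C" using constructs_ecc_tree by blast
qed

end
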